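(* Let $q>3$ be an odd prime power and let $\overline{\mathbb{F}_q}$ be an algebraic closure of the finite field $\mathbb{F}_q$. Let $A$ and $B$ be $\mathbb{F}_q$-subspaces of $\overline{\mathbb{F}_q}$ of size $q^3$, with $A^{-1}\not\subseteq B$, such that $$\frac{|A^{-1}\cap B|}{q-1}=2q+2.$$ Then the image of $A^{-1}\cap B$ in the projective plane $\mathbb{P}B$ is the union of a line and a conic.
   Context: For an $\mathbb{F}_q$-subspace $A$ of $\overline{\mathbb{F}_q}$, $A^{-1}=\{x^{-1}: 0\neq x\in A\}$ is the set of inverses of the nonzero elements of $A$. For an $\mathbb{F}_q$-vector space $V$, $\mathbb{P}V$ denotes the projective space over $\mathbb{F}_q$ whose points are the one-dimensional $\mathbb{F}_q$-subspaces of $V$; the image in $\mathbb{P}V$ of a set of nonzero vectors of $V$ is the set of the one-dimensional $\mathbb{F}_q$-subspaces they span. Here $B$ is three-dimensional over $\mathbb{F}_q$, so $\mathbb{P}B\cong PG(2,q)$. A line in $\mathbb{P}B$ is the set of points contained in a two-dimensional $\mathbb{F}_q$-subspace of $B$. A conic in $\mathbb{P}B$ is the set of $\mathbb{F}_q$-rational points of a nonsingular plane conic, i.e. the set of zeros in $\mathbb{P}B$ of a nondegenerate quadratic form on $B$ over $\mathbb{F}_q$ (it has $q+1$ points). *)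

theory Defs
  imports Complex_Main "HOL-Computational_Algebra.Computational_Algebra"
    "HOL-Number_Theory.Prime_Powers"
begin

text \<open>
  An algebraic closure of a field \<open>'k\<close>, given by an embedding of \<open>'k\<close> into an algebraically
  closed field \<open>'l\<close> that is algebraic over the image of \<open>'k\<close>.
\<close>

locale is_algebraic_closure =
  fixes emb :: "'k::field \<Rightarrow> 'l::alg_closed_field"
  assumes emb_one: "emb 1 = 1"
    and emb_add: "emb (a + b) = emb a + emb b"
    and emb_mult: "emb (a * b) = emb a * emb b"
    and algebraic: "\<exists>p::'k poly. p \<noteq> 0 \<and> poly (map_poly emb p) x = 0"

definition emb_scale :: "('k::field \<Rightarrow> 'l::field) \<Rightarrow> 'k \<Rightarrow> 'l \<Rightarrow> 'l" where
  "emb_scale emb c x = emb c * x"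

lemma (in is_algebraic_closure) vector_space_emb_scale: "vector_space (emb_scale emb)"
  by unfold_locales (simp_all add: emb_scale_def emb_one emb_add emb_mult algebra_simps)

definition inverse_set :: "'l::field set \<Rightarrow> 'l set" where
  "inverse_set A = {inverse x | x. x \<in> A \<and> x \<noteq> 0}"

definition polar_form :: "('b::ab_group_add \<Rightarrow> 'a::ab_group_add) \<Rightarrow> 'b \<Rightarrow> 'b \<Rightarrow> 'a" where
  "polar_form Q x y = Q (x + y) - Q x - Q y"

text \<open>
  In the following, \<open>s\<close> is the scalar multiplication of a vector space.
\<close>

definition proj_points :: "('a::field \<Rightarrow> 'b::ab_group_add \<Rightarrow> 'b) \<Rightarrow> 'b set \<Rightarrow> 'b set set" where
  "proj_points s V = {P. module.subspace s P \<and> P \<subseteq> V \<and> vector_space.dim s P = 1}"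

definition proj_image :: "('a::field \<Rightarrow> 'b::ab_group_add \<Rightarrow> 'b) \<Rightarrow> 'b set \<Rightarrow> 'b set set" where
  "proj_image s S = {module.span s {x} | x. x \<in> S}"

definition is_proj_line ::
  "('a::field \<Rightarrow> 'b::ab_group_add \<Rightarrow> 'b) \<Rightarrow> 'b set \<Rightarrow> 'b set set \<Rightarrow> bool" where
  "is_proj_line s V L \<longleftrightarrow>
     (\<exists>W. module.subspace s W \<and> W \<subseteq> V \<and> vector_space.dim s W = 2 \<and>
          L = {P \<in> proj_points s V. P \<subseteq> W})"

text \<open>
  Only the values of \<open>Q\<close> on \<open>V\<close> matter. Linearity of the polar form in its second argument
  follows by symmetry.
\<close>

definition quadratic_form_on ::
  "('a::field \<Rightarrow> 'b::ab_group_add \<Rightarrow> 'b) \<Rightarrow> 'b set \<Rightarrow> ('b \<Rightarrow> 'a) \<Rightarrow> bool" where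
  "quadratic_form_on s V Q \<longleftrightarrow>
     (\<forall>c. \<forall>x\<in>V. Q (s c x) = c\<^sup>2 * Q x) \<and>
     (\<forall>x\<in>V. \<forall>y\<in>V. \<forall>z\<in>V. polar_form Q (x + y) z = polar_form Q x z + polar_form Q y z) \<and>
     (\<forall>c. \<forall>x\<in>V. \<forall>y\<in>V. polar_form Q (s c x) y = c * polar_form Q x y)"

text \<open>
  This is the notion of nondegeneracy in characteristic other than 2; in characteristic 2
  the polar form is alternating, hence always degenerate when \<open>V\<close> has odd dimension.
\<close>

definition nondegenerate_on :: "'b::ab_group_add set \<Rightarrow> ('b \<Rightarrow> 'a::field) \<Rightarrow> bool" where
  "nondegenerate_on V Q \<longleftrightarrow> (\<forall>x\<in>V. (\<forall>y\<in>V. polar_form Q x y = 0) \<longrightarrow> x = 0)"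

text \<open>To be used for \<open>V\<close> of dimension 3 over a field of characteristic other than 2.\<close>

definition is_conic ::
  "('a::field \<Rightarrow> 'b::ab_group_add \<Rightarrow> 'b) \<Rightarrow> 'b set \<Rightarrow> 'b set set \<Rightarrow> bool" where
  "is_conic s V C \<longleftrightarrow>
     (\<exists>Q. quadratic_form_on s V Q \<and> nondegenerate_on V Q \<and>
          C = {P \<in> proj_points s V. \<forall>x\<in>P. Q x = 0})"

end

theory Submission
  imports Defs "HOL-Number_Theory.Residues" "HOL-Library.Cardinality"
begin

text \<open>
  The points of \<open>S = A\<^sup>-\<^sup>1 \<inter> B\<close> are the zeros on \<open>B\<close> of a cubic with values in the algebraic closure,
  so a line not contained in \<open>S\<close> meets it in at most three points. If \<open>S\<close> contained no line, then
  counting \<open>2 q + 2\<close> points along the lines through a point of \<open>S\<close> would show that each point lies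
  on exactly one 2-secant, all other lines through it being 3-secants; this is incompatible with the
  tangents of a cubic over the finite field \<open>K\<close> obtained by composing with a functional.

  So \<open>S\<close> contains a line, spanned by, say, \<open>1\<close> and \<open>z\<close> after a dilation. As the inverses of its elements
  lie in the three-dimensional space \<open>A\<close>, the degree of \<open>z\<close> over \<open>K\<close> is at most 3. In degree 3 the
  space \<open>A\<close> is the field \<open>K(z)\<close> and \<open>S\<close> is a subspace without \<open>0\<close>, of the wrong size. In degree 2 the line
  is the field \<open>E = K(z)\<close>, and \<open>B = E + K b\<close>, \<open>A = E + K b\<^sup>-\<^sup>1\<close> with \<open>b\<^sup>2 = \<beta> b + \<gamma>\<close> for some
  \<open>\<beta>, \<gamma> \<in> E\<close>. Outside \<open>E\<close>, the point \<open>e + t b\<close> lies in \<open>S\<close> iff \<open>(e\<^sup>2 + \<beta> e t) / \<gamma> \<in> K\<close>, which is the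
  vanishing of a quadratic form over \<open>K\<close>; the number of points forces it to be nondegenerate.
\<close>

section \<open>Three-dimensional subspaces and the inversion cubic\<close>

locale finite_field_extension =
  fixes emb :: "'k::{field,finite} \<Rightarrow> 'l::field" and q :: nat
  assumes card_k: "CARD('k) = q" and emb_1 [simp]: "emb 1 = 1"
    and emb_add: "emb (a + b) = emb a + emb b"
    and emb_mult: "emb (a * b) = emb a * emb b"
    and primepow_q: "primepow q"
    and odd_q: "odd q"
    and q_gt_3: "q > 3"
begin

sublocale vector_space "emb_scale emb"
  by unfold_locales (simp_all add: emb_scale_def emb_add emb_mult algebra_simps)

section \<open>The embedding as a homomorphism of fields\<close>

lemma emb_0 [simp]: "emb 0 = 0"
  by (metis add_cancel_right_right emb_add add_0)

lemma emb_minus: "emb (- a) = - emb a"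
  using emb_add[of a "- a"] by (simp add: add_eq_0_iff2)

lemma emb_diff: "emb (a - b) = emb a - emb b"
  using emb_add[of a "- b"] by (simp add: emb_minus)

lemma emb_eq_0_iff [simp]: "emb a = 0 \<longleftrightarrow> a = 0"
proof
  assume "emb a = 0"
  then have "emb (a * inverse a) = 0" by (simp add: emb_mult)
  then show "a = 0" by (metis emb_1 right_inverse zero_neq_one)
qed simp

lemma emb_inject [simp]: "emb a = emb b \<longleftrightarrow> a = b"
  using emb_eq_0_iff[of "a - b"] by (simp add: emb_diff)

lemma emb_inverse: "emb (inverse a) = inverse (emb a)"
proof (cases "a = 0")
  case False
  then have "emb (inverse a) * emb a = 1" by (simp flip: emb_mult)
  then show ?thesis by (metis inverse_unique mult.commute)
qed simp

lemma emb_divide: "emb (a / b) = emb a / emb b"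
  by (simp add: divide_inverse emb_mult emb_inverse)

lemma emb_power: "emb (a ^ n) = emb a ^ n"
  by (induction n) (simp_all add: emb_mult)

lemma subspace_iff:
  "subspace V \<longleftrightarrow> 0 \<in> V \<and> (\<forall>x\<in>V. \<forall>y\<in>V. x + y \<in> V) \<and> (\<forall>c. \<forall>x\<in>V. emb c * x \<in> V)"
  by (simp add: subspace_def emb_scale_def)

section \<open>Characteristic, Frobenius map and additive polynomials\<close>

lemma CHAR_pos_k: "CHAR('k) > 0"
  by (rule finite_imp_CHAR_pos) simp

lemma CHAR_ne_2: "CHAR('k) \<noteq> 2"
  using CHAR_dvd_CARD[where 'a='k, unfolded card_k] odd_q by auto

lemma two_ne_0_k: "(2::'k) \<noteq> 0"
proof
  assume "(2::'k) = 0"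
  then have "of_nat 2 = (0::'k)" by simp
  then have "CHAR('k) dvd 2" by (simp only: of_nat_eq_0_iff_char_dvd)
  then show False
    using CHAR_ne_2 CHAR_not_1'[where 'a='k] by (metis One_nat_def prime_nat_iff two_is_prime_nat)
qed

lemma emb_2 [simp]: "emb 2 = 2"
  using emb_add[of 1 1] by simp

lemma two_ne_0 [simp]: "(2::'l) \<noteq> 0"
  using two_ne_0_k emb_eq_0_iff[of 2] by simp

text \<open>\<open>CHAR('l)\<close> divides the prime \<open>CHAR('k)\<close>, hence equals it, and
  \<open>q\<close> is a power of that prime.\<close>

lemma frob_add: "((x::'l) + y) ^ q = x ^ q + y ^ q"
proof -
  have "of_nat CHAR('k) = (0::'l)"
  proof -
    have "emb (of_nat n) = of_nat n" for n by (induction n) (simp_all add: emb_add)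
    from this[of "CHAR('k)"] show ?thesis by simp
  qed
  moreover have pk: "prime CHAR('k)"
    using CHAR_pos_k prime_CHAR_semidom by blast
  ultimately have "CHAR('l) dvd CHAR('k)" by (simp add: of_nat_eq_0_iff_char_dvd)
  then have ch: "CHAR('l) = CHAR('k)"
    using pk CHAR_not_1'[where 'a='l] by (metis One_nat_def prime_nat_iff)
  obtain p n where pn: "prime p" "q = p ^ n"
    using primepow_q by (auto simp: primepow_def)
  have "CHAR('k) dvd p ^ n" using CHAR_dvd_CARD[where 'a='k, unfolded card_k] pn by simp
  then have "CHAR('k) = p"
    using pk pn(1) by (meson prime_dvd_power primes_dvd_imp_eq)
  then show ?thesis
    using freshmans_dream'[where 'a='l, of q n] pn ch by simp
qed

lemma frob_minus: "(- x ::'l) ^ q = - (x ^ q)"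
  using odd_q by simp

lemma frob_diff: "((x::'l) - y) ^ q = x ^ q - y ^ q"
  using frob_add[of x "- y"] by (simp add: frob_minus)

lemma power_q_k: "(x::'k) ^ q = x"
proof (cases "x = 0")
  case False
  have "x * (\<Prod>y\<in>UNIV-{0}. x * y) = x * x ^ (q - 1) * \<Prod>(UNIV-{0})"
    by (simp add: prod.distrib mult_ac card_k)
  also have "x * x ^ (q - 1) = x ^ Suc (q - 1)"
    by (subst power_Suc) auto
  also have "Suc (q - 1) = q" using q_gt_3 by simp
  also have "(\<Prod>y\<in>UNIV-{0}. x * y) = (\<Prod>y\<in>UNIV-{0}. y)"
    by (rule prod.reindex_bij_witness[of _ "\<lambda>y. y / x" "\<lambda>y. x * y"]) (use False in auto)
  finally show ?thesis by simp
qed (use q_gt_3 in \<open>simp add: power_0_left\<close>)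

lemma frob_emb [simp]: "emb c ^ q = emb c"
  by (simp add: power_q_k flip: emb_power)

text \<open>The \<open>q\<close> scalars are already all the roots that a polynomial of degree
  \<open>q\<close> can have.\<close>

lemma power_q_eq_self_iff: "(x::'l) ^ q = x \<longleftrightarrow> x \<in> range emb"
proof -
  define p :: "'l poly" where "p = Polynomial.monom 1 q - Polynomial.monom 1 1"
  have p: "poly p y = y ^ q - y" for y by (simp add: p_def poly_monom)
  have dp: "Polynomial.degree p \<le> q"
    unfolding p_def using q_gt_3 by (intro degree_diff_le) (auto simp: degree_monom_eq)
  have "Polynomial.coeff p q = 1" using q_gt_3 by (simp add: p_def)
  then have p0: "p \<noteq> 0" by auto
  have "range emb \<subseteq> {y. poly p y = 0}" by (auto simp: p)
  moreover have "finite {y. poly p y = 0}" using p0 by (rule poly_roots_finite)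
  moreover have "card {y. poly p y = 0} \<le> card (range emb)"
  proof -
    have "card {y. poly p y = 0} \<le> Polynomial.degree p" using p0 by (rule card_poly_roots_bound)
    also have "\<dots> \<le> q" by (rule dp)
    also have "q = card (range emb)" by (simp add: card_image inj_def card_k)
    finally show ?thesis .
  qed
  ultimately have "range emb = {y. poly p y = 0}" by (metis card_seteq)
  then show ?thesis by (auto simp: p)
qed

text \<open>Adjoins \<open>a\<close> to the kernel of \<open>f\<close>: the left-hand side is
  \<open>f a ^ q\<close> times the value of X^q - X at \<open>f t / f a\<close>, and the roots of
  X^q - X are the scalars. For \<open>f a = 0\<close> it is \<open>f t ^ q\<close>, and the kernel
  stays the same.\<close>

lemma kernel_extend:
  assumes add: "\<And>x y. f (x + y) = f x + f y" and scale: "\<And>c x. f (emb c * x) = emb c * f x"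
  shows "f t ^ q - f a ^ (q - 1) * f t = 0 \<longleftrightarrow> (\<exists>r. f (t - emb r * a) = (0::'l))"
proof -
  have f_diff: "f (t - emb r * a) = f t - emb r * f a" for r
    using add[of "t - emb r * a" "emb r * a"] by (simp add: scale)
  have qs: "x * x ^ (q - 1) = x ^ q" for x :: 'l
    using q_gt_3 by (simp flip: power_Suc)
  show ?thesis
  proof (cases "f a = 0")
    case True
    then show ?thesis using q_gt_3 by (auto simp: f_diff power_0_left)
  next
    case False
    have "f t ^ q - f a ^ (q - 1) * f t = f a ^ q * ((f t / f a) ^ q - f t / f a)"
      using False by (simp add: field_simps qs flip: power_Suc)
        (simp add: qs[of "f a", symmetric] mult_ac)
    then have "f t ^ q - f a ^ (q - 1) * f t = 0 \<longleftrightarrow> f t / f a \<in> range emb"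
      using False by (simp flip: power_q_eq_self_iff)
    also have "\<dots> \<longleftrightarrow> (\<exists>r. f (t - emb r * a) = 0)"
      unfolding f_diff using False by (auto simp: image_iff field_simps)
    finally show ?thesis .
  qed
qed

text \<open>Three applications of \<open>kernel_extend\<close>, starting from the identity, adjoin
  \<open>a\<close>, \<open>b\<close> and \<open>c\<close> in turn.\<close>

lemma subspace_polynomial:
  obtains c0 c1 c2 where
    "\<And>t. t ^ (q ^ 3) + c2 * t ^ (q ^ 2) + c1 * t ^ q + c0 * t = 0 \<longleftrightarrow>
      (\<exists>r s u. t = emb r * a + emb s * b + emb u * c)"
proof -
  define f1 where "f1 t = t ^ q - a ^ (q - 1) * t" for t :: 'l
  define f2 where "f2 t = f1 t ^ q - f1 b ^ (q - 1) * f1 t" for t :: 'l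
  define f3 where "f3 t = f2 t ^ q - f2 c ^ (q - 1) * f2 t" for t :: 'l
  have a1: "f1 (x + y) = f1 x + f1 y" "f1 (emb k * x) = emb k * f1 x" for x y k
    by (simp_all add: f1_def frob_add power_mult_distrib algebra_simps)
  have a2: "f2 (x + y) = f2 x + f2 y" "f2 (emb k * x) = emb k * f2 x" for x y k
    by (simp_all only: f2_def a1 frob_add power_mult_distrib frob_emb) (simp_all add: algebra_simps)
  have "f3 t = 0 \<longleftrightarrow> (\<exists>u. f2 (t - emb u * c) = 0)" for t
    unfolding f3_def by (rule kernel_extend) (rule a2)+
  moreover have "f2 t = 0 \<longleftrightarrow> (\<exists>s. f1 (t - emb s * b) = 0)" for t
    unfolding f2_def by (rule kernel_extend) (rule a1)+
  moreover have "f1 t = 0 \<longleftrightarrow> (\<exists>r. t - emb r * a = 0)" for t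
    unfolding f1_def by (rule kernel_extend) simp_all
  ultimately have "f3 t = 0 \<longleftrightarrow> (\<exists>u s r. t - emb u * c - emb s * b - emb r * a = 0)" for t
    by simp
  also have "(\<exists>u s r. t - emb u * c - emb s * b - emb r * a = 0) \<longleftrightarrow>
      (\<exists>r s u. t = emb r * a + emb s * b + emb u * c)" for t
    by (auto simp: algebra_simps)
  finally have z: "f3 t = 0 \<longleftrightarrow> (\<exists>r s u. t = emb r * a + emb s * b + emb u * c)" for t .
  obtain k1 k2 k3 where k: "f1 t = t ^ q - k1 * t" "f2 t = f1 t ^ q - k2 * f1 t"
    "f3 t = f2 t ^ q - k3 * f2 t" for t
    using f1_def f2_def f3_def by blast
  have pw: "t ^ (q ^ 2) = (t ^ q) ^ q" "t ^ (q ^ 3) = ((t ^ q) ^ q) ^ q" for t :: 'l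
    by (simp_all add: power2_eq_square power3_eq_cube power_mult)
  \<comment> \<open>Here \<open>t1\<close>, \<open>t2\<close>, \<open>t3\<close> stand for the
    iterated \<open>q\<close>-th powers of \<open>t0\<close>, \<open>u1\<close> and
    \<open>u2\<close> for those of \<open>k1\<close>, and \<open>v1\<close> for
    \<open>k2 ^ q\<close>; the composition becomes a plain polynomial identity.\<close>
  have expand: "t3 - u2 * t2 - v1 * (t2 - u1 * t1) - k3 * (t2 - u1 * t1 - k2 * (t1 - k1 * t0)) =
      t3 + (- u2 - v1 - k3) * t2 + (v1 * u1 + k3 * u1 + k3 * k2) * t1 + - (k3 * k2 * k1) * t0"
    for t0 t1 t2 t3 u1 u2 v1 :: 'l
    by (simp add: algebra_simps)
  have "f3 t = t ^ (q ^ 3) + (- ((k1 ^ q) ^ q) - k2 ^ q - k3) * t ^ (q ^ 2)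
      + ((k2 * k1) ^ q + k3 * k1 ^ q + k3 * k2) * t ^ q + (- (k3 * k2 * k1)) * t" for t
    unfolding k pw by (simp only: frob_diff power_mult_distrib) (simp only: expand)
  note z[unfolded this]
  then show thesis by (rule that)
qed

section \<open>Linear independence and spans in coordinates\<close>

definition indep2 :: "'l \<Rightarrow> 'l \<Rightarrow> bool" where
  "indep2 a b \<longleftrightarrow> (\<forall>r s. emb r * a + emb s * b = 0 \<longrightarrow> r = 0 \<and> s = 0)"

definition indep3 :: "'l \<Rightarrow> 'l \<Rightarrow> 'l \<Rightarrow> bool" where
  "indep3 a b c \<longleftrightarrow>
    (\<forall>r s u. emb r * a + emb s * b + emb u * c = 0 \<longrightarrow> r = 0 \<and> s = 0 \<and> u = 0)"

definition span2 :: "'l \<Rightarrow> 'l \<Rightarrow> 'l set" where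
  "span2 a b = range (\<lambda>(r, s). emb r * a + emb s * b)"

definition span3 :: "'l \<Rightarrow> 'l \<Rightarrow> 'l \<Rightarrow> 'l set" where
  "span3 a b c = range (\<lambda>(r, s, u). emb r * a + emb s * b + emb u * c)"

lemma mem_span2_iff: "x \<in> span2 a b \<longleftrightarrow> (\<exists>r s. x = emb r * a + emb s * b)"
  by (auto simp: span2_def)

lemma mem_span3_iff: "x \<in> span3 a b c \<longleftrightarrow> (\<exists>r s u. x = emb r * a + emb s * b + emb u * c)"
  by (simp add: span3_def image_iff split_paired_Ex)

lemma indep2_eqD:
  assumes "indep2 a b" "emb r * a + emb s * b = emb r' * a + emb s' * b"
  shows "r = r'" "s = s'"
proof -
  have "emb (r - r') * a + emb (s - s') * b = 0"
    using assms(2) by (simp add: emb_diff algebra_simps)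
  then have "r - r' = 0 \<and> s - s' = 0"
    using assms(1) unfolding indep2_def by blast
  then show "r = r'" "s = s'" by simp_all
qed

lemma indep3_eqD:
  assumes "indep3 a b c" "emb r * a + emb s * b + emb u * c = emb r' * a + emb s' * b + emb u' * c"
  shows "r = r'" "s = s'" "u = u'"
proof -
  have "emb (r - r') * a + emb (s - s') * b + emb (u - u') * c = 0"
    using assms(2) by (simp add: emb_diff algebra_simps)
  then have "r - r' = 0 \<and> s - s' = 0 \<and> u - u' = 0"
    using assms(1) unfolding indep3_def by blast
  then show "r = r'" "s = s'" "u = u'" by simp_all
qed

lemma card_span2: "indep2 a b \<Longrightarrow> card (span2 a b) = q ^ 2"
  unfolding span2_def
  by (subst card_image)
    (auto intro!: inj_onI simp: card_cartesian_product power2_eq_square card_k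
      simp flip: UNIV_Times_UNIV dest: indep2_eqD)

lemma card_span3: "indep3 a b c \<Longrightarrow> card (span3 a b c) = q ^ 3"
  unfolding span3_def
  by (subst card_image)
    (auto intro!: inj_onI simp: card_cartesian_product power3_eq_cube card_k
      simp flip: UNIV_Times_UNIV dest: indep3_eqD)

lemma finite_span2: "finite (span2 a b)"
  by (simp add: span2_def)

lemma finite_span3: "finite (span3 a b c)"
  by (simp add: span3_def)

lemma span2_subset: "subspace V \<Longrightarrow> a \<in> V \<Longrightarrow> b \<in> V \<Longrightarrow> span2 a b \<subseteq> V"
  by (auto simp: span2_def subspace_iff)

lemma span3_subset: "subspace V \<Longrightarrow> a \<in> V \<Longrightarrow> b \<in> V \<Longrightarrow> c \<in> V \<Longrightarrow> span3 a b c \<subseteq> V"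
  by (auto simp: span3_def subspace_iff)

lemma finite_card_cube: "card V = q ^ 3 \<Longrightarrow> finite V"
  using q_gt_3 by (intro card_ge_0_finite) simp

lemma span3_eq:
  assumes "subspace V" "card V = q ^ 3" "indep3 a b c" "a \<in> V" "b \<in> V" "c \<in> V"
  shows "V = span3 a b c"
  using card_subset_eq[OF finite_card_cube span3_subset] card_span3 assms by metis

lemma indep2I:
  assumes "a \<noteq> 0" "\<And>r. b \<noteq> emb r * a"
  shows "indep2 a b"
  unfolding indep2_def
proof (intro allI impI)
  fix r s assume eq: "emb r * a + emb s * b = 0"
  have "s = 0"
  proof (rule ccontr)
    assume "s \<noteq> 0"
    then have "b = emb (- r / s) * a"
      using eq by (simp add: emb_divide emb_minus field_simps add_eq_0_iff)
    with assms show False by blast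
  qed
  with eq assms show "r = 0 \<and> s = 0" by simp
qed

lemma indep3I:
  assumes "indep2 a b" "c \<notin> span2 a b"
  shows "indep3 a b c"
  unfolding indep3_def
proof (intro allI impI)
  fix r s u assume eq: "emb r * a + emb s * b + emb u * c = 0"
  have "u = 0"
  proof (rule ccontr)
    assume "u \<noteq> 0"
    then have "c = emb (- r / u) * a + emb (- s / u) * b"
      using eq by (simp add: emb_divide emb_minus field_simps)
        (metis add.assoc add.commute add_eq_0_iff mult.commute)
    with assms show False by (auto simp: span2_def)
  qed
  with eq assms show "r = 0 \<and> s = 0 \<and> u = 0" by (auto simp: indep2_def)
qed

lemma indep2_swap: "indep2 a b \<Longrightarrow> indep2 b a"
  by (metis indep2_def add.commute)

lemma indep3_imp_indep2: "indep3 a b c \<Longrightarrow> indep2 a b"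
  unfolding indep3_def indep2_def by (metis add.right_neutral emb_0 mult_zero_left)

lemma indep3_rotate: "indep3 a b c \<Longrightarrow> indep3 b c a"
  unfolding indep3_def by (metis add.assoc add.commute)

lemma indep3_swap: "indep3 a b c \<Longrightarrow> indep3 b a c"
  unfolding indep3_def by (metis add.commute)

lemma indep3_shift:
  assumes "indep3 a b c"
  shows "indep3 a (b + emb t * a) c" "indep3 a b (c + emb t * b)"
proof -
  show "indep3 a (b + emb t * a) c"
    unfolding indep3_def
  proof (intro allI impI)
    fix r s u assume "emb r * a + emb s * (b + emb t * a) + emb u * c = 0"
    then have "emb (r + s * t) * a + emb s * b + emb u * c = 0"
      by (simp add: emb_add emb_mult algebra_simps)
    then show "r = 0 \<and> s = 0 \<and> u = 0" using assms by (fastforce simp: indep3_def)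
  qed
  show "indep3 a b (c + emb t * b)"
    unfolding indep3_def
  proof (intro allI impI)
    fix r s u assume "emb r * a + emb s * b + emb u * (c + emb t * b) = 0"
    then have "emb r * a + emb (s + u * t) * b + emb u * c = 0"
      by (simp add: emb_add emb_mult algebra_simps)
    then show "r = 0 \<and> s = 0 \<and> u = 0" using assms by (fastforce simp: indep3_def)
  qed
qed

lemma indep2_extend:
  assumes "card V = q ^ 3" "indep2 a b"
  obtains c where "c \<in> V" "indep3 a b c"
proof -
  have "q ^ 2 < q ^ 3" using q_gt_3 by (intro power_strict_increasing) auto
  then have "\<not> V \<subseteq> span2 a b"
    using card_mono[OF finite_span2, of V a b] card_span2[OF assms(2)] assms(1) by auto
  then show thesis using that indep3I[OF assms(2)] by blast
qed

lemma indep2_extend1: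
  assumes "card V = q ^ 3" "a \<noteq> 0"
  obtains b where "b \<in> V" "indep2 a b"
proof -
  have "q ^ 1 < q ^ 3" using q_gt_3 by (intro power_strict_increasing) auto
  moreover have "card (range (\<lambda>r. emb r * a)) \<le> q" using card_image_le[of UNIV "\<lambda>r. emb r * a"] card_k by simp
  ultimately have "\<not> V \<subseteq> range (\<lambda>r. emb r * a)"
    using card_mono[of "range (\<lambda>r. emb r * a)" V] assms(1) by auto
  then obtain b where "b \<in> V" "b \<notin> range (\<lambda>r. emb r * a)" by blast
  then show thesis using that indep2I[OF assms(2)] by blast
qed

lemma subspace_eq_span3:
  assumes "subspace V" "card V = q ^ 3"
  obtains a b c where "a \<in> V" "b \<in> V" "c \<in> V" "indep3 a b c" "V = span3 a b c"
proof -
  have "q ^ 0 < q ^ 3" using q_gt_3 by (intro power_strict_increasing) auto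
  then have "\<not> V \<subseteq> {0}" using card_mono[of "{0}" V] assms by auto
  then obtain a where "a \<in> V" "a \<noteq> 0" by blast
  moreover from this obtain b where "b \<in> V" "indep2 a b" using indep2_extend1 assms(2) by metis
  moreover from this obtain c where "c \<in> V" "indep3 a b c" using indep2_extend assms(2) by metis
  ultimately show thesis using that span3_eq[OF assms] by blast
qed

section \<open>Functionals over the ground field and the inversion cubic\<close>

lemma functional_exists:
  assumes "v \<noteq> (0::'l)"
  obtains f :: "'l \<Rightarrow> 'k" where "\<And>x y. f (x + y) = f x + f y" "\<And>c x. f (emb c * x) = c * f x" "f v \<noteq> 0"
proof -
  interpret P: vector_space_pair "emb_scale emb" "(*) :: 'k \<Rightarrow> 'k \<Rightarrow> 'k"
    by unfold_locales (simp_all add: algebra_simps)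
  have "independent {v}" using assms by (metis independent_empty independent_insertI span_empty singletonD)
  from P.linear_independent_extend[OF this, of "\<lambda>_. 1"]
  obtain f where f: "Vector_Spaces.linear (emb_scale emb) (*) f" "f v = 1" by auto
  interpret f: Vector_Spaces.linear "emb_scale emb" "(*)" f by (rule f)
  show thesis
    using that[of f] f.add f.scale f(2) by (simp add: emb_scale_def)
qed

definition trilinear :: "('l \<Rightarrow> 'l \<Rightarrow> 'l \<Rightarrow> 'l) \<Rightarrow> bool" where
  "trilinear T \<longleftrightarrow>
    (\<forall>x x' y z. T (x + x') y z = T x y z + T x' y z) \<and>
    (\<forall>x y y' z. T x (y + y') z = T x y z + T x y' z) \<and>
    (\<forall>x y z z'. T x y (z + z') = T x y z + T x y z') \<and>
    (\<forall>c x y z. T (emb c * x) y z = emb c * T x y z) \<and>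
    (\<forall>c x y z. T x (emb c * y) z = emb c * T x y z) \<and>
    (\<forall>c x y z. T x y (emb c * z) = emb c * T x y z)"

text \<open>
  If \<open>P\<close> is the additive polynomial with zero set \<open>A\<close>, then \<open>x ^ (1 + q + q\<^sup>2 + q\<^sup>3) * P (1 / x)\<close> is
  a sum of products of three of the four \<open>K\<close>-linear maps \<open>x\<close>, \<open>x ^ q\<close>, \<open>x ^ q\<^sup>2\<close>, \<open>x ^ q\<^sup>3\<close>.
\<close>

lemma inverse_cubic:
  assumes "subspace A" "card A = q ^ 3"
  obtains T where "trilinear T" "\<And>x. x \<noteq> 0 \<Longrightarrow> T x x x = 0 \<longleftrightarrow> inverse x \<in> A"
proof -
  obtain a b c where "A = span3 a b c" using subspace_eq_span3[OF assms] by metis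
  moreover obtain c0 c1 c2 where
    "\<And>t. t ^ (q ^ 3) + c2 * t ^ (q ^ 2) + c1 * t ^ q + c0 * t = 0 \<longleftrightarrow>
      (\<exists>r s u. t = emb r * a + emb s * b + emb u * c)"
    by (rule subspace_polynomial[of a b c]) blast
  ultimately have A: "t \<in> A \<longleftrightarrow> t ^ (q ^ 3) + c2 * t ^ (q ^ 2) + c1 * t ^ q + c0 * t = 0" for t
    by (simp add: mem_span3_iff)
  have pw: "t ^ (q ^ 2) = (t ^ q) ^ q" "t ^ (q ^ 3) = ((t ^ q) ^ q) ^ q" for t :: 'l
    by (simp_all add: power2_eq_square power3_eq_cube power_mult)
  define T where "T x y z = x * y ^ q * (z ^ q) ^ q + c2 * (x * y ^ q * ((z ^ q) ^ q) ^ q)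
    + c1 * (x * (y ^ q) ^ q * ((z ^ q) ^ q) ^ q) + c0 * (x ^ q * (y ^ q) ^ q * ((z ^ q) ^ q) ^ q)" for x y z
  show thesis
  proof (rule that)
    show "trilinear T"
      unfolding trilinear_def T_def
      by (simp only: frob_add power_mult_distrib frob_emb) (simp add: distrib_left distrib_right mult_ac add_ac)
    fix x :: 'l assume x: "x \<noteq> 0"
    have "T x x x = x * x ^ q * (x ^ q) ^ q * ((x ^ q) ^ q) ^ q *
      (inverse x ^ (q ^ 3) + c2 * inverse x ^ (q ^ 2) + c1 * inverse x ^ q + c0 * inverse x)"
      unfolding T_def pw using x by (simp add: power_inverse field_simps)
    then show "T x x x = 0 \<longleftrightarrow> inverse x \<in> A" using x by (simp add: A)
  qed
qed

end

section \<open>Plane cubics without lines\<close>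

text \<open>Contradictory assumptions, gathered for a proof by contradiction: the cubic vanishes on
  no line of the plane. \<open>S\<close> consists of vectors, so each of its
  \<open>2 * q + 2\<close> points is counted \<open>q - 1\<close> times.\<close>

locale cubic_section = finite_field_extension emb q
  for emb :: "'k::{field,finite} \<Rightarrow> 'l::field" and q +
  fixes T :: "'l \<Rightarrow> 'l \<Rightarrow> 'l \<Rightarrow> 'l" and B S :: "'l set"
  assumes trilin: "trilinear T"
    and subspace_B: "subspace B" and card_B: "card B = q ^ 3"
    and S_def: "S = {x \<in> B. x \<noteq> 0 \<and> T x x x = 0}"
    and card_S: "card S = (q - 1) * (2 * q + 2)"
    and no_line: "indep2 x y \<Longrightarrow> x \<in> B \<Longrightarrow> y \<in> B \<Longrightarrow>
      \<exists>r s. T (emb r * x + emb s * y) (emb r * x + emb s * y) (emb r * x + emb s * y) \<noteq> 0"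
begin

lemma T_add:
  "T (x + x') y z = T x y z + T x' y z"
  "T x (y + y') z = T x y z + T x y' z"
  "T x y (z + z') = T x y z + T x y z'"
  using trilin by (simp_all add: trilinear_def)

lemma T_scale:
  "T (emb c * x) y z = emb c * T x y z"
  "T x (emb c * y) z = emb c * T x y z"
  "T x y (emb c * z) = emb c * T x y z"
  using trilin by (simp_all add: trilinear_def)

lemma B_add: "x \<in> B \<Longrightarrow> y \<in> B \<Longrightarrow> x + y \<in> B"
  and B_scale: "x \<in> B \<Longrightarrow> emb c * x \<in> B"
  using subspace_B by (auto simp: subspace_iff)

lemma S_scale: "x \<in> S \<Longrightarrow> c \<noteq> 0 \<Longrightarrow> emb c * x \<in> S"
  by (simp add: S_def B_scale T_scale)

lemma S_scale_iff: "c \<noteq> 0 \<Longrightarrow> emb c * x \<in> S \<longleftrightarrow> x \<in> S"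
  using S_scale[of x c] S_scale[of "emb c * x" "inverse c"]
  by (auto simp: emb_inverse simp flip: mult.assoc)

text \<open>The derivative of the cubic form at \<open>x\<close> in direction
  \<open>y\<close>.\<close>

definition D1 :: "'l \<Rightarrow> 'l \<Rightarrow> 'l" where
  "D1 x y = T x x y + T x y x + T y x x"

text \<open>For independent \<open>P\<close> and \<open>v\<close>, the number of points of
  \<open>S\<close> other than \<open>P\<close> on their line: each has exactly one representative
  \<open>v + emb t * P\<close>. For \<open>P\<close> in \<open>S\<close>, a 2-secant has value 1 and
  a 3-secant value 2.\<close>

definition N :: "'l \<Rightarrow> 'l \<Rightarrow> nat" where
  "N P v = card {t. v + emb t * P \<in> S}"

lemma T_line: "T (emb r * x + emb s * y) (emb r * x + emb s * y) (emb r * x + emb s * y) =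
    emb (r ^ 3) * T x x x + emb (r ^ 2 * s) * D1 x y + emb (r * s ^ 2) * D1 y x + emb (s ^ 3) * T y y y"
  by (simp only: T_add T_scale) (simp add: D1_def emb_mult power2_eq_square power3_eq_cube algebra_simps)

lemma N_le_2:
  assumes "P \<in> S" "v \<in> B" "indep2 P v"
  shows "N P v \<le> 2"
proof -
  \<comment> \<open>The cubic along the line, as a polynomial in \<open>t\<close>; its top
    coefficient \<open>T P P P\<close> is zero because \<open>P\<close> lies in
    \<open>S\<close>.\<close>
  define p where "p = [:T v v v, D1 v P, D1 P v:]"
  have P: "P \<in> B" "T P P P = 0" using assms by (auto simp: S_def)
  have "p \<noteq> 0"
  proof
    assume "p = 0"
    then have "T v v v = 0" "D1 v P = 0" "D1 P v = 0" by (simp_all add: p_def)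
    then show False using no_line[OF assms(3) P(1) assms(2)] by (simp only: T_line P(2)) simp
  qed
  then have fin: "finite {x. poly p x = 0}" by (rule poly_roots_finite)
  have "T (v + emb t * P) (v + emb t * P) (v + emb t * P) = poly p (emb t)" for t
    using T_line[of 1 v t P] P(2)
    by (simp add: p_def emb_power emb_mult power2_eq_square algebra_simps)
  then have "emb ` {t. v + emb t * P \<in> S} \<subseteq> {x. poly p x = 0}"
    by (auto simp: S_def)
  then have "card (emb ` {t. v + emb t * P \<in> S}) \<le> card {x. poly p x = 0}"
    by (rule card_mono[OF fin])
  also have "\<dots> \<le> Polynomial.degree p" using \<open>p \<noteq> 0\<close> by (rule card_poly_roots_bound)
  also have "\<dots> \<le> 2" by (simp add: p_def)
  finally show ?thesis by (simp add: N_def card_image inj_on_def)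
qed

section \<open>Counting along the lines through a point of \<open>S\<close>\<close>

lemma card_units: "card (UNIV - {0::'k}) = q - 1"
  by (simp add: card_Diff_singleton card_k)

text \<open>The \<open>q + 1\<close> lines through \<open>P\<close> in the plane partition the other
  \<open>2 * q + 1\<close> points of \<open>S\<close>; \<open>f\<close> gives one of these lines,
  the vectors \<open>e + emb t * f\<close> give the others.\<close>

lemma sum_N:
  assumes P: "P \<in> S" and ind: "indep3 P e f" and B: "e \<in> B" "f \<in> B"
  shows "N P f + (\<Sum>t\<in>UNIV. N P (e + emb t * f)) = 2 * q + 1"
proof -
  define U where "U = UNIV - {0::'k}"
  \<comment> \<open>\<open>S1\<close> holds the multiples of \<open>P\<close>, \<open>S2\<close> the
    other vectors of \<open>S\<close> on the line through \<open>P\<close> and \<open>f\<close>, and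
    \<open>S3\<close> those with a nonzero coordinate at \<open>e\<close>. The coordinates in
    \<open>form2\<close> and \<open>form3\<close> tell them apart.\<close>
  define S1 where "S1 = (\<lambda>r. emb r * P) ` U"
  define I2 where "I2 = U \<times> {t. f + emb t * P \<in> S}"
  define S2 where "S2 = (\<lambda>(r, t). emb r * (f + emb t * P)) ` I2"
  define I3 where "I3 = U \<times> Sigma UNIV (\<lambda>s. {t. (e + emb s * f) + emb t * P \<in> S})"
  define S3 where "S3 = (\<lambda>(r, s, t). emb r * ((e + emb s * f) + emb t * P)) ` I3"
  have form2: "emb r * (f + emb t * P) = emb (r * t) * P + emb 0 * e + emb r * f" for r t
    by (simp add: emb_mult algebra_simps)
  have form3: "emb r * ((e + emb s * f) + emb t * P) = emb (r * t) * P + emb r * e + emb (r * s) * f" for r s t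
    by (simp add: emb_mult algebra_simps)
  note eqD = indep3_eqD[OF ind]
  have "P \<noteq> 0" using P by (simp add: S_def)
  have c1: "card S1 = q - 1"
    unfolding S1_def U_def by (subst card_image) (auto intro!: inj_onI simp: card_units \<open>P \<noteq> 0\<close>)
  have i2: "inj_on (\<lambda>(r, t). emb r * (f + emb t * P)) I2"
  proof (rule inj_onI, clarify)
    fix r t r' t'
    assume "(r, t) \<in> I2" and "emb r * (f + emb t * P) = emb r' * (f + emb t' * P)"
    then show "r = r' \<and> t = t'"
      unfolding form2 using eqD[of "r * t" 0 r "r' * t'" 0 r'] by (auto simp: I2_def U_def)
  qed
  have i3: "inj_on (\<lambda>(r, s, t). emb r * ((e + emb s * f) + emb t * P)) I3"
  proof (rule inj_onI)
    fix x y assume I: "x \<in> I3" "y \<in> I3"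
      and eq: "(\<lambda>(r, s, t). emb r * ((e + emb s * f) + emb t * P)) x =
        (\<lambda>(r, s, t). emb r * ((e + emb s * f) + emb t * P)) y"
    obtain r s t where x: "x = (r, s, t)" by (rule prod_cases3)
    obtain r' s' t' where y: "y = (r', s', t')" by (rule prod_cases3)
    show "x = y"
      using I eq unfolding x y prod.case form3
      using eqD[of "r * t" r "r * s" "r' * t'" r' "r' * s'"] by (auto simp: I3_def U_def)
  qed
  have c2: "card S2 = (q - 1) * N P f"
    unfolding S2_def by (subst card_image[OF i2]) (simp add: I2_def card_cartesian_product U_def card_units N_def)
  have c3: "card S3 = (q - 1) * (\<Sum>t\<in>UNIV. N P (e + emb t * f))"
    unfolding S3_def
    by (subst card_image[OF i3]) (simp add: I3_def card_cartesian_product U_def card_units N_def)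
  have fin: "finite S1" "finite S2" "finite S3"
    by (simp_all add: S1_def S2_def S3_def I2_def I3_def)
  have "S = S1 \<union> S2 \<union> S3"
  proof
    show "S1 \<union> S2 \<union> S3 \<subseteq> S"
      using P by (auto simp: S1_def S2_def S3_def I2_def I3_def U_def intro!: S_scale)
    show "S \<subseteq> S1 \<union> S2 \<union> S3"
    proof
      fix x assume x: "x \<in> S"
      have "x \<in> span3 P e f"
        using x span3_eq[OF subspace_B card_B ind] P B by (auto simp: S_def)
      then obtain a b c where abc: "x = emb a * P + emb b * e + emb c * f"
        by (auto simp: mem_span3_iff)
      show "x \<in> S1 \<union> S2 \<union> S3"
      proof (cases "b = 0")
        case False
        then have eq: "x = emb b * ((e + emb (c / b) * f) + emb (a / b) * P)"
          by (simp add: abc emb_divide field_simps)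
        then have "(b, c / b, a / b) \<in> I3"
          using x False by (simp add: I3_def U_def S_scale_iff)
        then show ?thesis unfolding S3_def using eq by force
      next
        case b: True
        show ?thesis
        proof (cases "c = 0")
          case False
          then have eq: "x = emb c * (f + emb (a / c) * P)"
            by (simp add: abc b emb_divide field_simps)
          then have "(c, a / c) \<in> I2"
            using x False by (simp add: I2_def U_def S_scale_iff)
          then show ?thesis unfolding S2_def using eq by force
        next
          case True
          then have "x = emb a * P" by (simp add: abc b)
          moreover from this x have "a \<noteq> 0" by (auto simp: S_def)
          ultimately show ?thesis by (auto simp: S1_def U_def)
        qed
      qed
    qed
  qed
  moreover have "emb r * P \<noteq> emb r' * (f + emb t * P)" if "r' \<noteq> 0" for r r' t
    using eqD(3)[of r 0 0 "r' * t" 0 r'] that unfolding form2 by auto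
  then have "S1 \<inter> S2 = {}"
    by (auto simp: S1_def S2_def I2_def U_def)
  moreover have "emb r * P \<noteq> emb r' * ((e + emb s * f) + emb t * P)" if "r' \<noteq> 0" for r r' s t
    using eqD(2)[of r 0 0 "r' * t" r' "r' * s"] that unfolding form3 by auto
  then have "S1 \<inter> S3 = {}"
    by (auto simp: S1_def S3_def I3_def U_def)
  moreover have "r' = 0"
    if "emb r * (f + emb t' * P) = emb r' * ((e + emb s * f) + emb t * P)" for r r' s t t'
    using eqD(2)[of "r * t'" 0 r "r' * t" r' "r' * s"] that unfolding form2 form3 by auto
  then have "S2 \<inter> S3 = {}"
    unfolding S2_def S3_def I2_def I3_def U_def by fast
  ultimately have "card S = card S1 + card S2 + card S3"
    using fin by (simp add: card_Un_disjoint Int_Un_distrib2)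
  then have "(q - 1) * (2 * q + 2) = (q - 1) * (1 + (N P f + (\<Sum>t\<in>UNIV. N P (e + emb t * f))))"
    unfolding card_S c1 c2 c3 by (simp only: distrib_left mult_1_right add.assoc)
  then have "2 * q + 2 = 1 + (N P f + (\<Sum>t\<in>UNIV. N P (e + emb t * f)))"
    using q_gt_3 by (subst (asm) mult_cancel1) simp
  then show ?thesis by simp
qed

lemma N_shift: "N P (v + emb t * P) = N P v"
  unfolding N_def
  by (rule bij_betw_same_card[of "\<lambda>s. s + t"], rule bij_betw_byWitness[of _ "\<lambda>s. s - t"])
    (auto simp: emb_add emb_diff algebra_simps)

text \<open>A 2-secant leaves \<open>2 * q\<close> points for the other \<open>q\<close> lines
  through \<open>P\<close>, each with at most two, so all of these are 3-secants.\<close>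

lemma N_eq_2:
  assumes "P \<in> S" "indep3 P v w" "v \<in> B" "w \<in> B" "N P v = 1"
  shows "N P (w + emb t * v) = 2"
proof (rule ccontr)
  have "N P (w + emb s * v) \<le> 2" for s
  proof (rule N_le_2)
    have "indep3 P (w + emb s * v) v"
      using assms(2) by (meson indep3_shift indep3_swap indep3_rotate)
    then show "indep2 P (w + emb s * v)" by (rule indep3_imp_indep2)
  qed (use assms B_add B_scale in auto)
  moreover assume "N P (w + emb t * v) \<noteq> 2"
  ultimately have "(\<Sum>t\<in>UNIV. N P (w + emb t * v)) < (\<Sum>t\<in>(UNIV::'k set). 2)"
    by (intro sum_strict_mono_ex1) (auto simp: le_neq_implies_less intro: exI[of _ t])
  moreover have "N P v + (\<Sum>t\<in>UNIV. N P (w + emb t * v)) = 2 * q + 1"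
    using assms by (intro sum_N) (auto dest: indep3_swap indep3_rotate)
  ultimately show False using assms(5) by (simp add: card_k)
qed

text \<open>If every line through \<open>P\<close> had two further points, there would be
  \<open>2 * (q + 1)\<close> of them, one too many. So some line has at most one, and then exactly
  one, since the other \<open>q\<close> lines account for at most \<open>2 * q\<close>.\<close>

lemma two_secant_exists:
  assumes P: "P \<in> S"
  obtains P' where "P' \<in> S" "indep2 P P'" "N P P' = 1"
proof -
  have PB: "P \<in> B" "P \<noteq> 0" using P by (simp_all add: S_def)
  obtain f where f: "f \<in> B" "indep2 P f" using indep2_extend1[OF card_B PB(2)] .
  obtain e where e: "e \<in> B" "indep3 P f e" using indep2_extend[OF card_B f(2)] .
  have sum: "N P f + (\<Sum>t\<in>UNIV. N P (e + emb t * f)) = 2 * q + 1"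
    using e f P by (intro sum_N) (auto dest: indep3_swap indep3_rotate)
  have "\<exists>v\<in>B. indep2 P v \<and> N P v \<le> 1"
  proof (rule ccontr)
    assume "\<not> ?thesis"
    then have ge: "N P v \<ge> 2" if "v \<in> B" "indep2 P v" for v using that by force
    have "indep2 P (e + emb t * f)" for t
    proof -
      have "indep3 P (e + emb t * f) f"
        using e(2) by (meson indep3_shift indep3_swap indep3_rotate)
      then show ?thesis by (rule indep3_imp_indep2)
    qed
    then have "(\<Sum>t\<in>(UNIV::'k set). 2) \<le> (\<Sum>t\<in>UNIV. N P (e + emb t * f))"
      using e f by (intro sum_mono ge) (auto intro: B_add B_scale)
    then show False using sum ge[OF f] by (simp add: card_k)
  qed
  then obtain v where v: "v \<in> B" "indep2 P v" "N P v \<le> 1" by blast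
  obtain w where w: "w \<in> B" "indep3 P v w" using indep2_extend[OF card_B v(2)] .
  have sum: "N P v + (\<Sum>t\<in>UNIV. N P (w + emb t * v)) = 2 * q + 1"
    using v w P by (intro sum_N) (auto dest: indep3_swap indep3_rotate)
  have "N P (w + emb t * v) \<le> 2" for t
  proof (rule N_le_2[OF P])
    have "indep3 P (w + emb t * v) v"
      using w(2) by (meson indep3_shift indep3_swap indep3_rotate)
    then show "indep2 P (w + emb t * v)" by (rule indep3_imp_indep2)
  qed (use v w B_add B_scale in auto)
  then have "(\<Sum>t\<in>UNIV. N P (w + emb t * v)) \<le> (\<Sum>t\<in>(UNIV::'k set). 2)"
    by (intro sum_mono)
  then have N1: "N P v = 1" using sum v(3) by (simp add: card_k)
  then obtain t where t: "v + emb t * P \<in> S" unfolding N_def by (metis card_1_singletonE mem_Collect_eq singletonI)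
  have "indep2 P (v + emb t * P)"
    using indep3_shift(1)[OF w(2)] by (rule indep3_imp_indep2)
  then show thesis using that t N1 by (simp add: N_shift)
qed

text \<open>\<open>P\<close> and \<open>P'\<close> are the only points of \<open>S\<close> on their
  line, which is a symmetric condition; scaling by \<open>inverse t\<close> exchanges the two
  parametrisations.\<close>

lemma two_secant_sym:
  assumes "P \<in> S" "P' \<in> S" "N P P' = 1"
  shows "N P' P = 1"
proof -
  have "0 \<in> {t. P' + emb t * P \<in> S}" using assms by simp
  then have single: "{t. P' + emb t * P \<in> S} = {0}"
    using assms(3) unfolding N_def by (metis card_1_singletonE singletonD)
  have "{t. P + emb t * P' \<in> S} = {0}"
  proof -
    have "t = 0" if "P + emb t * P' \<in> S" for t
    proof (rule ccontr)
      assume t: "t \<noteq> 0"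
      have "P + emb t * P' = emb t * (P' + emb (inverse t) * P)"
        using t by (simp add: emb_inverse distrib_left add.commute flip: mult.assoc)
      then have "P' + emb (inverse t) * P \<in> S"
        using that t by (simp add: S_scale_iff)
      then have "inverse t \<in> {t. P' + emb t * P \<in> S}" by simp
      with single t show False by simp
    qed
    then show ?thesis using assms(1) by auto
  qed
  then show ?thesis by (simp add: N_def)
qed

section \<open>Tangents of the cubic at the points of a 2-secant\<close>

definition T0 :: "'l \<Rightarrow> 'l \<Rightarrow> 'l \<Rightarrow> 'l" where
  "T0 x y z = T x y z + T x z y + T y x z + T y z x + T z x y + T z y x"

text \<open>The ten coefficients of the cubic in coordinates of the plane; \<open>T0\<close>, the
  full polarisation, belongs to the monomial \<open>r * s * u\<close>.\<close>

lemma T_plane: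
  fixes x y z :: "'l" and r s u :: 'k
  defines "w \<equiv> emb r * x + emb s * y + emb u * z"
  shows "T w w w =
    emb (r ^ 3) * T x x x + emb (r ^ 2 * s) * D1 x y + emb (r * s ^ 2) * D1 y x + emb (s ^ 3) * T y y y
    + emb (r ^ 2 * u) * D1 x z + emb (r * s * u) * T0 x y z + emb (s ^ 2 * u) * D1 y z
    + emb (r * u ^ 2) * D1 z x + emb (s * u ^ 2) * D1 z y + emb (u ^ 3) * T z z z"
  unfolding w_def
  by (simp only: T_add T_scale)
    (simp add: D1_def T0_def emb_mult power2_eq_square power3_eq_cube algebra_simps)

text \<open>
  Compose the cubic with a functional that does not vanish at \<open>D1 P P'\<close>. On a suitable line
  through \<open>P\<close> other than \<open>PP'\<close>, the resulting cubic over \<open>K\<close> has a double zero at \<open>P\<close> and two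
  more zeros, so it vanishes there and becomes a linear form times a conic. The other lines
  through \<open>P'\<close> being 3-secants, the conic meets too many of them twice outside \<open>P'\<close>.
\<close>

lemma two_secant_D1_eq_0:
  assumes PP: "P \<in> S" "P' \<in> S" and ind: "indep2 P P'" and N1: "N P P' = 1"
  shows "D1 P P' = 0"
proof (rule ccontr)
  assume "D1 P P' \<noteq> 0"
  then obtain f :: "'l \<Rightarrow> 'k" where f_add: "\<And>x y. f (x + y) = f x + f y"
    and f_scale: "\<And>c x. f (emb c * x) = c * f x" and f0: "f (D1 P P') \<noteq> 0"
    using functional_exists by metis
  have PB: "P \<in> B" "P' \<in> B" and TP: "T P P P = 0" "T P' P' P' = 0" using PP by (auto simp: S_def)
  obtain w where w: "w \<in> B" "indep3 P P' w" using indep2_extend[OF card_B ind] .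
  \<comment> \<open>Chosen so that \<open>v\<close> is a tangent direction at \<open>P\<close> for
    the composed cubic, that is, \<open>f (D1 P v) = 0\<close>. The line through \<open>P\<close>
    and \<open>v\<close> is not the 2-secant, hence it is a 3-secant.\<close>
  define k where "k = - f (D1 P w) / f (D1 P P')"
  define v where "v = w + emb k * P'"
  have v: "v \<in> B" "indep3 P P' v"
    using w PB indep3_shift(2) by (auto simp: v_def B_add B_scale)
  have "D1 P v = D1 P w + emb k * D1 P P'"
    unfolding v_def D1_def by (simp only: T_add T_scale) (simp add: algebra_simps)
  then have Dv: "f (D1 P v) = 0"
    using f0 by (simp add: f_add f_scale k_def)
  define Z where "Z = {t. v + emb t * P \<in> S}"
  have cZ: "card Z = 2"
    using N_eq_2[OF PP(1) w(2) PB(2) w(1) N1, of k] by (simp add: N_def Z_def v_def)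
  have f_sub0: "f 0 = 0" using f_scale[of 0 0] by simp
  \<comment> \<open>The composed cubic at \<open>v + emb t * P + emb u * P'\<close>, without the
    terms that vanish because of \<open>P\<close>, \<open>P'\<close> and the choice of
    \<open>v\<close>.\<close>
  have F: "t * f (D1 v P) + f (T v v v) + t ^ 2 * u * f (D1 P P') + t * u * f (T0 P v P')
      + u * f (D1 v P') + t * u ^ 2 * f (D1 P' P) + u ^ 2 * f (D1 P' v) = 0"
    if "v + emb t * P + emb u * P' \<in> S" for t u
  proof -
    let ?w = "emb t * P + emb 1 * v + emb u * P'"
    have "f (T ?w ?w ?w) = 0" using that by (simp add: S_def f_sub0 add_ac)
    then show ?thesis
      unfolding T_plane by (simp only: f_add f_scale TP Dv) (simp add: f_sub0 algebra_simps)
  qed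
  obtain t1 t2 where t12: "Z = {t1, t2}" "t1 \<noteq> t2" using cZ by (auto simp: card_2_iff)
  have F0: "t * f (D1 v P) + f (T v v v) = 0" if "t \<in> Z" for t
    using F[of t 0] that by (simp add: Z_def)
  \<comment> \<open>On the line \<open>u = 0\<close> the composed cubic has become linear in
    \<open>t\<close>, yet it has the two roots \<open>t1\<close> and \<open>t2\<close>; so it
    vanishes there and \<open>u\<close> can be divided out.\<close>
  have "(t1 - t2) * f (D1 v P) = (t1 * f (D1 v P) + f (T v v v)) - (t2 * f (D1 v P) + f (T v v v))"
    by (simp add: algebra_simps)
  also have "\<dots> = 0" using t12(1) by (simp add: F0)
  finally have "f (D1 v P) = 0" using t12(2) by simp
  then have m0: "f (D1 v P) = 0" "f (T v v v) = 0"
    using t12(1) F0[of t1] by simp_all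
  have indP': "indep3 P' P v" using v(2) by (rule indep3_swap)
  have N1': "N P' P = 1" using two_secant_sym[OF PP N1] .
  \<comment> \<open>The remaining factor is \<open>poly p t\<close> plus \<open>u\<close> times a
    linear polynomial in \<open>t\<close>; the leading coefficient of \<open>p\<close> is nonzero by
    the choice of \<open>f\<close>.\<close>
  define p where "p = [:f (D1 v P'), f (T0 P v P'), f (D1 P P'):]"
  have "p \<noteq> 0" using f0 by (simp add: p_def)
  have "UNIV - Z \<subseteq> {t. poly p t = 0}"
  proof clarify
    \<comment> \<open>The line through \<open>P'\<close> and \<open>v + emb t * P\<close> is a
      3-secant whose two further points both have \<open>u \<noteq> 0\<close>. The conic equation is
      linear in \<open>u\<close> with these two roots, so both of its coefficients vanish.\<close>
    fix t assume t: "t \<notin> Z"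
    have "card {u. v + emb t * P + emb u * P' \<in> S} = 2"
      using N_eq_2[OF PP(2) indP' PB(1) v(1) N1', of t] by (simp add: N_def)
    then obtain u1 u2 where u: "{u. v + emb t * P + emb u * P' \<in> S} = {u1, u2}" "u1 \<noteq> u2"
      by (auto simp: card_2_iff)
    have u0: "u \<noteq> 0" if "u \<in> {u1, u2}" for u
      using that t unfolding u(1)[symmetric] Z_def by auto
    have eq: "poly p t + u * (t * f (D1 P' P) + f (D1 P' v)) = 0" if "u \<in> {u1, u2}" for u
    proof -
      have "u * (poly p t + u * (t * f (D1 P' P) + f (D1 P' v))) = 0"
        using F[of t u] that unfolding u(1)[symmetric]
        by (simp add: m0 p_def power2_eq_square algebra_simps)
      then show ?thesis using u0[OF that] by simp
    qed
    have "(u1 - u2) * (t * f (D1 P' P) + f (D1 P' v)) =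
        (poly p t + u1 * (t * f (D1 P' P) + f (D1 P' v))) - (poly p t + u2 * (t * f (D1 P' P) + f (D1 P' v)))"
      by (simp only: left_diff_distrib add_diff_cancel_left)
    also have "\<dots> = 0" by (simp only: eq insertI1 insertI2 diff_self)
    finally have "t * f (D1 P' P) + f (D1 P' v) = 0" using u(2) by simp
    then show "poly p t = 0" using eq[of u1] by simp
  qed
  then have "card (UNIV - Z) \<le> card {t. poly p t = 0}"
    by (rule card_mono[OF poly_roots_finite[OF \<open>p \<noteq> 0\<close>]])
  also have "\<dots> \<le> Polynomial.degree p" using \<open>p \<noteq> 0\<close> by (rule card_poly_roots_bound)
  also have "\<dots> \<le> 2" by (simp add: p_def)
  finally have "q - 2 \<le> 2" using cZ by (simp add: card_Diff_subset card_k)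
  then have "q = 4" using q_gt_3 by linarith
  then show False using odd_q by simp
qed

text \<open>With both derivatives zero, all four coefficients of the cubic on the line through
  \<open>P\<close> and \<open>P'\<close> vanish, against \<open>no_line\<close>.\<close>

lemma contradiction: False
proof -
  have "card S \<noteq> 0" using card_S q_gt_3 by simp
  then obtain P where P: "P \<in> S" by fastforce
  obtain P' where P': "P' \<in> S" "indep2 P P'" "N P P' = 1" using two_secant_exists[OF P] .
  have "D1 P P' = 0" using two_secant_D1_eq_0[OF P P'] .
  moreover have "D1 P' P = 0"
    using two_secant_D1_eq_0[OF P'(1) P indep2_swap[OF P'(2)] two_secant_sym[OF P P'(1,3)]] .
  moreover have "T P P P = 0" "T P' P' P' = 0" "P \<in> B" "P' \<in> B" using P P' by (auto simp: S_def)
  ultimately show False using no_line[OF P'(2)] by (simp add: T_line)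
qed

end

text \<open>If the inversion cubic vanished on no line of \<open>B\<close>, the section would
  satisfy the assumptions of \<open>cubic_section\<close>.\<close>

lemma (in finite_field_extension) contains_line:
  assumes "subspace A" "card A = q ^ 3" "subspace B" "card B = q ^ 3"
    and card: "card (inverse_set A \<inter> B) = (q - 1) * (2 * q + 2)"
  obtains x y where "indep2 x y" "x \<in> B" "y \<in> B"
    "\<And>r s. (r, s) \<noteq> (0, 0) \<Longrightarrow> inverse (emb r * x + emb s * y) \<in> A"
proof -
  obtain T where T: "trilinear T" "\<And>x. x \<noteq> 0 \<Longrightarrow> T x x x = 0 \<longleftrightarrow> inverse x \<in> A"
    by (rule inverse_cubic[OF assms(1,2)]) (rule that)
  have S: "inverse_set A \<inter> B = {x \<in> B. x \<noteq> 0 \<and> T x x x = 0}"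
    using T(2) unfolding inverse_set_def by force
  have "\<exists>x y. indep2 x y \<and> x \<in> B \<and> y \<in> B \<and>
    (\<forall>r s. T (emb r * x + emb s * y) (emb r * x + emb s * y) (emb r * x + emb s * y) = 0)"
  proof (rule ccontr)
    assume "\<not> ?thesis"
    then interpret cubic_section emb q T B "inverse_set A \<inter> B"
      by unfold_locales (use T(1) assms(3,4) S card in blast)+
    show False by (rule contradiction)
  qed
  then obtain x y where xy: "indep2 x y" "x \<in> B" "y \<in> B"
    and T0: "\<And>r s. T (emb r * x + emb s * y) (emb r * x + emb s * y) (emb r * x + emb s * y) = 0"
    by blast
  show thesis
  proof (rule that[OF xy])
    fix r s :: 'k assume "(r, s) \<noteq> (0, 0)"
    then have "emb r * x + emb s * y \<noteq> 0" using xy(1) by (auto simp: indep2_def)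
    then show "inverse (emb r * x + emb s * y) \<in> A" using T(2) T0 by metis
  qed
qed

section \<open>Sections containing a line\<close>

text \<open>Multiplication by \<open>x\<close> is injective on the finite set \<open>E\<close>,
  hence onto; this puts first \<open>1\<close> and then \<open>inverse x\<close> into
  \<open>E\<close>.\<close>

lemma finite_closed_inverse:
  fixes E :: "'a::field set"
  assumes "finite E" and mult: "\<And>x y. x \<in> E \<Longrightarrow> y \<in> E \<Longrightarrow> x * y \<in> E" and "x \<in> E" "x \<noteq> 0"
  shows "inverse x \<in> E"
proof -
  have "(\<lambda>y. x * y) ` E = E"
    using assms by (intro card_subset_eq) (auto simp: card_image inj_on_def)
  then obtain e where e: "e \<in> E" "x = x * e" using \<open>x \<in> E\<close> by (metis imageE)
  then have "e = 1" using \<open>x \<noteq> 0\<close> by simp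
  then obtain y where "y \<in> E" "1 = x * y" using e(1) \<open>(\<lambda>y. x * y) ` E = E\<close> by (metis imageE)
  then show ?thesis by (metis inverse_unique)
qed

section \<open>Spans as subspaces, and the degree of \<open>z\<close> over the ground field\<close>

context finite_field_extension
begin

lemma subspace_span2: "subspace (span2 a b)"
  unfolding subspace_iff
proof (intro conjI ballI allI)
  show "0 \<in> span2 a b" unfolding mem_span2_iff by (intro exI[of _ 0]) simp
next
  fix x y assume "x \<in> span2 a b" "y \<in> span2 a b"
  then obtain r s r' s' where "x = emb r * a + emb s * b" "y = emb r' * a + emb s' * b"
    by (auto simp: mem_span2_iff)
  then have "x + y = emb (r + r') * a + emb (s + s') * b" by (simp add: emb_add algebra_simps)
  then show "x + y \<in> span2 a b" unfolding mem_span2_iff by blast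
next
  fix c x assume "x \<in> span2 a b"
  then obtain r s where "x = emb r * a + emb s * b" by (auto simp: mem_span2_iff)
  then have "emb c * x = emb (c * r) * a + emb (c * s) * b" by (simp add: emb_mult algebra_simps)
  then show "emb c * x \<in> span2 a b" unfolding mem_span2_iff by blast
qed

lemma subspace_span3: "subspace (span3 a b c)"
  unfolding subspace_iff
proof (intro conjI ballI allI)
  show "0 \<in> span3 a b c" unfolding mem_span3_iff by (intro exI[of _ 0]) simp
next
  fix x y assume "x \<in> span3 a b c" "y \<in> span3 a b c"
  then obtain r s t r' s' t' where "x = emb r * a + emb s * b + emb t * c"
    "y = emb r' * a + emb s' * b + emb t' * c"
    by (auto simp: mem_span3_iff)
  then have "x + y = emb (r + r') * a + emb (s + s') * b + emb (t + t') * c"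
    by (simp add: emb_add algebra_simps)
  then show "x + y \<in> span3 a b c" unfolding mem_span3_iff by blast
next
  fix k x assume "x \<in> span3 a b c"
  then obtain r s t where "x = emb r * a + emb s * b + emb t * c" by (auto simp: mem_span3_iff)
  then have "emb k * x = emb (k * r) * a + emb (k * s) * b + emb (k * t) * c"
    by (simp add: emb_mult algebra_simps)
  then show "emb k * x \<in> span3 a b c" unfolding mem_span3_iff by blast
qed

lemma mem_span2: "a \<in> span2 a b" "b \<in> span2 a b"
  unfolding mem_span2_iff by (rule exI[of _ 1], rule exI[of _ 0], simp)
    (rule exI[of _ 0], rule exI[of _ 1], simp)

lemma mem_span3: "a \<in> span3 a b c" "b \<in> span3 a b c" "c \<in> span3 a b c"
  unfolding mem_span3_iff
  by (rule exI[of _ 1], rule exI[of _ 0], rule exI[of _ 0], simp)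
    (rule exI[of _ 0], rule exI[of _ 1], rule exI[of _ 0], simp,
     rule exI[of _ 0], rule exI[of _ 0], rule exI[of _ 1], simp)

lemma card_subspace_cases:
  assumes V: "subspace V" "finite V" and ab: "indep2 a b" "a \<in> V" "b \<in> V"
  shows "card V = q ^ 2 \<or> q ^ 3 \<le> card V"
proof (cases "V \<subseteq> span2 a b")
  case True
  then show ?thesis using span2_subset[OF V(1) ab(2,3)] card_span2[OF ab(1)] by simp
next
  case False
  then obtain c where c: "c \<in> V" "indep3 a b c" using indep3I[OF ab(1)] by blast
  have "card (span3 a b c) \<le> card V"
    using span3_subset[OF V(1) ab(2,3) c(1)] V(2) by (rule card_mono[rotated])
  then show ?thesis by (simp add: card_span3[OF c(2)])
qed

text \<open>Otherwise \<open>1\<close>, \<open>z\<close>, \<open>z * z\<close> are independent, the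
  inverses of \<open>1\<close>, \<open>z\<close>, \<open>1 + z\<close> form a basis of
  \<open>A\<close>, and expressing the inverse of \<open>1 - z\<close> in it yields a cubic equation
  for \<open>z\<close>. Then \<open>A\<close> is the field generated by \<open>z\<close>, and the
  section is the subspace \<open>A \<inter> B\<close> without zero, which has the wrong
  size.\<close>

lemma inverse_line_quadratic:
  assumes A: "subspace A" "card A = q ^ 3" and B: "subspace B" "card B = q ^ 3"
    and ind: "indep2 1 z" and zB: "1 \<in> B" "z \<in> B"
    and line: "\<And>r s. (r, s) \<noteq> (0, 0) \<Longrightarrow> inverse (emb r + emb s * z) \<in> A"
    and card: "card (inverse_set A \<inter> B) = (q - 1) * (2 * q + 2)"
  shows "z * z \<in> span2 1 z"
proof (rule ccontr)
  assume "z * z \<notin> span2 1 z"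
  then have i3: "indep3 1 z (z * z)" using ind by (rule indep3I[rotated])
  have nz: "z \<noteq> 0" "1 + z \<noteq> 0" "1 - z \<noteq> 0"
    using ind[unfolded indep2_def, rule_format, of 0 1] ind[unfolded indep2_def, rule_format, of 1 1]
      ind[unfolded indep2_def, rule_format, of 1 "-1"] by (auto simp: emb_minus)
  have inA: "1 \<in> A" "inverse z \<in> A" "inverse (1 + z) \<in> A" "inverse (1 - z) \<in> A"
    using line[of 1 0] line[of 0 1] line[of 1 1] line[of 1 "-1"] by (simp_all add: emb_minus)
  \<comment> \<open>Multiplying by \<open>z * (1 + z)\<close> moves the inverses into the basis
    \<open>1\<close>, \<open>z\<close>, \<open>z * z\<close>, where coefficients can be
    compared.\<close>
  have clear: "z * (1 + z) * (emb r * 1 + emb s * inverse z + emb u * inverse (1 + z)) =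
      emb s * 1 + emb (r + s + u) * z + emb r * (z * z)" for r s u
  proof -
    have "z * (1 + z) * (emb r * 1 + emb s * inverse z + emb u * inverse (1 + z)) =
      emb r * (z * (1 + z)) + emb s * (1 + z) * (z * inverse z) + emb u * z * ((1 + z) * inverse (1 + z))"
      by (simp only: algebra_simps mult_1_left mult_1_right)
    also have "\<dots> = emb r * (z * (1 + z)) + emb s * (1 + z) + emb u * z" using nz by simp
    finally show ?thesis by (simp add: emb_add algebra_simps)
  qed
  have "indep3 1 (inverse z) (inverse (1 + z))"
    unfolding indep3_def
  proof (intro allI impI)
    fix r s u assume "emb r * 1 + emb s * inverse z + emb u * inverse (1 + z) = 0"
    then have "emb s * 1 + emb (r + s + u) * z + emb r * (z * z) = 0"
      using clear[of r s u] by simp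
    then have "s = 0 \<and> r + s + u = 0 \<and> r = 0" using i3 unfolding indep3_def by blast
    then show "r = 0 \<and> s = 0 \<and> u = 0" by auto
  qed
  then have A_eq: "A = span3 1 (inverse z) (inverse (1 + z))" using span3_eq[OF A] inA by blast
  define E where "E = span3 1 z (z * z)"
  have E: "subspace E" "finite E" "card E = q ^ 3"
    by (simp_all add: E_def subspace_span3 finite_span3 card_span3 i3)
  have E1: "1 \<in> E" "z \<in> E" "z * z \<in> E" by (simp_all add: E_def mem_span3)
  have E_add: "x \<in> E \<Longrightarrow> y \<in> E \<Longrightarrow> x + y \<in> E" and E_scale: "x \<in> E \<Longrightarrow> emb k * x \<in> E" for x y k
    using E(1) by (auto simp: subspace_iff)
  obtain r s u where rsu: "inverse (1 - z) = emb r * 1 + emb s * inverse z + emb u * inverse (1 + z)"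
    using inA(4) unfolding A_eq mem_span3_iff by blast
  have "z * (1 + z) = (1 - z) * (z * (1 + z) * inverse (1 - z))" using nz by (simp add: field_simps)
  also have "\<dots> = (1 - z) * (emb s * 1 + emb (r + s + u) * z + emb r * (z * z))"
    unfolding rsu clear ..
  finally have cubic: "emb r * (z * (z * z)) = emb s * 1 + emb (r + u - 1) * z + emb (- s - u - 1) * (z * z)"
    by (simp add: emb_add emb_diff emb_minus algebra_simps)
  \<comment> \<open>For \<open>r = 0\<close>, comparing coefficients gives \<open>s = 0\<close> and
    both \<open>u = 1\<close> and \<open>u = -1\<close>, which odd characteristic excludes.\<close>
  have "r \<noteq> 0"
  proof
    assume "r = 0"
    then have "emb s * 1 + emb (r + u - 1) * z + emb (- s - u - 1) * (z * z) = 0" using cubic by simp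
    then have "s = 0 \<and> r + u - 1 = 0 \<and> - s - u - 1 = 0" using i3 unfolding indep3_def by blast
    then have "(2::'k) = 0" using \<open>r = 0\<close> by (auto simp: algebra_simps)
    then show False using two_ne_0_k by simp
  qed
  have "emb r * (z * (z * z)) \<in> E" unfolding cubic E_def mem_span3_iff by blast
  from E_scale[OF this, of "inverse r"] have z3: "z * (z * z) \<in> E"
    using \<open>r \<noteq> 0\<close> by (simp only: mult.assoc[symmetric] emb_mult[symmetric]) simp
  have zE: "z * x \<in> E" if x: "x \<in> E" for x
  proof -
    obtain a b c where "x = emb a * 1 + emb b * z + emb c * (z * z)"
      using x unfolding E_def mem_span3_iff by blast
    then have "z * x = emb a * z + emb b * (z * z) + emb c * (z * (z * z))" by (simp add: algebra_simps)
    then show ?thesis using E1 z3 by (simp add: E_add E_scale)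
  qed
  have E_mult: "x * y \<in> E" if x: "x \<in> E" and y: "y \<in> E" for x y
  proof -
    obtain a b c where "x = emb a * 1 + emb b * z + emb c * (z * z)"
      using x unfolding E_def mem_span3_iff by blast
    then have "x * y = emb a * y + emb b * (z * y) + emb c * (z * (z * y))" by (simp add: algebra_simps)
    then show ?thesis using y by (simp add: E_add E_scale zE)
  qed
  have E_inv: "inverse x \<in> E" if "x \<in> E" for x
    using finite_closed_inverse[OF E(2) E_mult, of x] that by (cases "x = 0") auto
  have "A \<subseteq> E"
    unfolding A_eq using E1 E_inv E_add by (intro span3_subset E(1)) auto
  then have "A = E" using E A by (intro card_subset_eq) auto
  have "inverse_set A \<inter> B = (E \<inter> B) - {0}"
    unfolding \<open>A = E\<close> inverse_set_def using E_inv by (auto intro: exI[of _ "inverse _"])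
  moreover have "0 \<in> E \<inter> B" using E(1) B(1) by (simp add: subspace_0)
  \<comment> \<open>This is \<open>2 * q ^ 2 - 1\<close>, strictly between \<open>q ^ 2\<close> and
    \<open>q ^ 3\<close>, which is no possible size for a subspace containing \<open>1\<close> and
    \<open>z\<close>.\<close>
  ultimately have "card (E \<inter> B) = (q - 1) * (2 * q + 2) + 1"
    using card E(2) card_Suc_Diff1[of "E \<inter> B" 0] by simp
  moreover have "(q - 1) * (2 * q + 2) + 1 + 1 = 2 * q ^ 2"
    using q_gt_3 by (cases q) (simp_all add: power2_eq_square algebra_simps)
  moreover have "card (E \<inter> B) = q ^ 2 \<or> q ^ 3 \<le> card (E \<inter> B)"
    using E B E1 zB ind by (intro card_subspace_cases[of "E \<inter> B" 1 z] subspace_inter) auto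
  moreover have "2 * q ^ 2 < q ^ 3" "q ^ 2 > 1"
    using q_gt_3 by (auto simp: power2_eq_square power3_eq_cube intro: less_1_mult[of q q, simplified])
  ultimately show False by linarith
qed

text \<open>Supplies the coordinate functionals \<open>\<phi>\<close> and \<open>\<tau>\<close> from
  which the conic is built.\<close>

lemma functional_extends:
  assumes ind: "indep3 a b c"
  obtains f :: "'l \<Rightarrow> 'k" where "\<And>x y. f (x + y) = f x + f y" "\<And>k x. f (emb k * x) = k * f x"
    "f a = r" "f b = s" "f c = t"
proof -
  interpret P: vector_space_pair "emb_scale emb" "(*) :: 'k \<Rightarrow> 'k \<Rightarrow> 'k"
    by unfold_locales (simp_all add: algebra_simps)
  have dist: "a \<noteq> b" "a \<noteq> c" "b \<noteq> c"
    using ind[unfolded indep3_def, rule_format, of 1 "-1" 0]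
      ind[unfolded indep3_def, rule_format, of 1 0 "-1"]
      ind[unfolded indep3_def, rule_format, of 0 1 "-1"] by (auto simp: emb_minus)
  have "c \<noteq> 0" using ind[unfolded indep3_def, rule_format, of 0 0 1] by auto
  then have "independent {c}" by (metis independent_empty independent_insertI span_empty singletonD)
  moreover have "b \<notin> span {c}"
  proof
    assume "b \<in> span {c}"
    then obtain k where "b = emb k * c" by (auto simp: span_singleton emb_scale_def)
    then show False using ind[unfolded indep3_def, rule_format, of 0 1 "-k"] by (auto simp: emb_minus)
  qed
  moreover have "a \<notin> span {b, c}"
  proof
    assume "a \<in> span {b, c}"
    then obtain k l where "a - emb k * b = emb l * c"
      by (auto simp: span_insert[of b "{c}"] span_singleton emb_scale_def)
    then show False using ind[unfolded indep3_def, rule_format, of 1 "-k" "-l"]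
      by (auto simp: emb_minus algebra_simps)
  qed
  ultimately have "independent {a, b, c}" by (simp add: independent_insertI)
  from P.linear_independent_extend[OF this, of "\<lambda>x. if x = a then r else if x = b then s else t"]
  obtain f where f: "Vector_Spaces.linear (emb_scale emb) (*) f" "f a = r" "f b = s" "f c = t"
    using dist by auto
  interpret f: Vector_Spaces.linear "emb_scale emb" "(*)" f by (rule f)
  show thesis
    using that[of f] f.add f.scale f by (simp add: emb_scale_def)
qed

end

section \<open>The residual conic\<close>

text \<open>\<open>E\<close> is the quadratic extension field generated by \<open>z\<close>, given
  as a plain span: closure under products comes from \<open>zz_E\<close>, closure under inverses
  from finiteness.\<close>

locale quadratic_line = finite_field_extension emb q
  for emb :: "'k::{field,finite} \<Rightarrow> 'l::field" and q +
  fixes z :: 'l and E :: "'l set"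
  assumes E_def: "E = span2 1 z" and ind_E: "indep2 1 z" and zz_E: "z * z \<in> E"
begin

lemma E_1: "1 \<in> E" and E_z: "z \<in> E"
  by (simp_all add: E_def mem_span2)

lemma subspace_E: "subspace E"
  by (simp add: E_def subspace_span2)

lemma finite_E: "finite E"
  by (simp add: E_def finite_span2)

lemma E_0: "0 \<in> E" and E_add: "x \<in> E \<Longrightarrow> y \<in> E \<Longrightarrow> x + y \<in> E"
  and E_scale: "x \<in> E \<Longrightarrow> emb k * x \<in> E"
  using subspace_E by (auto simp: subspace_iff)

lemma E_emb: "emb k \<in> E"
  using E_scale[OF E_1] by simp

lemma E_mult:
  assumes x: "x \<in> E" and y: "y \<in> E"
  shows "x * y \<in> E"
proof -
  obtain r s r' s' where "x = emb r * 1 + emb s * z" "y = emb r' * 1 + emb s' * z"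
    using x y unfolding E_def mem_span2_iff by blast
  then have "x * y = emb (r * r') + emb (r * s' + s * r') * z + emb (s * s') * (z * z)"
    by (simp add: emb_mult emb_add algebra_simps)
  then show ?thesis by (simp only: E_add E_scale E_emb E_z zz_E)
qed

lemma E_inverse: "x \<in> E \<Longrightarrow> inverse x \<in> E"
  using finite_closed_inverse[OF finite_E E_mult] E_0 by (cases "x = 0") auto

lemma E_divide: "x \<in> E \<Longrightarrow> y \<in> E \<Longrightarrow> x / y \<in> E"
  by (simp add: divide_inverse E_mult E_inverse)

lemma E_minus: "x \<in> E \<Longrightarrow> - x \<in> E"
  using E_scale[of x "-1"] by (simp add: emb_minus)

lemma E_diff: "x \<in> E \<Longrightarrow> y \<in> E \<Longrightarrow> x - y \<in> E"
  using E_add[OF _ E_minus, of x y] by simp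

lemmas E_intros = E_0 E_1 E_z E_add E_scale E_emb E_mult E_inverse E_divide E_minus E_diff

lemma indep3_not_mem: "b \<notin> E \<Longrightarrow> indep3 1 z b"
  using indep3I[OF ind_E] by (simp add: E_def)

lemma mem_span3_E: "x \<in> span3 1 z b \<longleftrightarrow> (\<exists>e\<in>E. \<exists>t. x = e + emb t * b)"
  by (fastforce simp: mem_span3_iff E_def mem_span2_iff)

text \<open>\<open>S\<close> is too large for \<open>E\<close> and one further point, so it contains
  \<open>b\<close> outside \<open>E\<close> and \<open>e1 + b\<close> with \<open>e1\<close> nonzero
  in \<open>E\<close>. Writing \<open>inverse (e1 + b)\<close> as an element of \<open>E\<close>
  plus a multiple of \<open>inverse b\<close> and clearing denominators gives a quadratic equation
  for \<open>b\<close> over \<open>E\<close>.\<close>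

lemma quadratic_relation:
  assumes A: "subspace A" "card A = q ^ 3" "E \<subseteq> A" and B: "subspace B" "card B = q ^ 3" "E \<subseteq> B"
    and card: "card {x \<in> B. x \<noteq> 0 \<and> inverse x \<in> A} = (q - 1) * (2 * q + 2)"
  obtains b \<beta> \<gamma> where "b \<notin> E" "A = span3 1 z (inverse b)" "B = span3 1 z b"
    "\<beta> \<in> E" "\<gamma> \<in> E" "\<gamma> \<noteq> 0" "b * b = \<beta> * b + \<gamma>"
proof -
  define S where "S = {x \<in> B. x \<noteq> 0 \<and> inverse x \<in> A}"
  have cS: "card S = (q - 1) * (2 * q + 2)" using card by (simp add: S_def)
  have S_scale: "emb k * x \<in> S" if "x \<in> S" "k \<noteq> 0" for k x
    using that A(1) B(1) by (auto simp: S_def subspace_iff simp flip: emb_inverse)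
  have cE: "card (E - {0}) = q ^ 2 - 1"
    using E_0 by (simp add: card_Diff_singleton E_def card_span2 ind_E)
  have q2: "q ^ 2 - 1 + q < (q - 1) * (2 * q + 2)"
    using q_gt_3 by (cases q) (simp_all add: power2_eq_square algebra_simps)
  have "\<not> S \<subseteq> E - {0}"
    using card_mono[of "E - {0}" S] finite_E cE cS q2 by auto
  then obtain b where b: "b \<in> S" "b \<notin> E" by (auto simp: S_def)
  define R where "R = range (\<lambda>r. emb r * b)"
  have "card R \<le> q"
    unfolding R_def using card_image_le[of UNIV "\<lambda>r. emb r * b"] card_k by simp
  then have "card ((E - {0}) \<union> R) \<le> q ^ 2 - 1 + q"
    using card_Un_le[of "E - {0}" R] cE by simp
  moreover have "finite ((E - {0}) \<union> R)" using finite_E by (simp add: R_def)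
  ultimately have "\<not> S \<subseteq> (E - {0}) \<union> R"
    using card_mono[of "(E - {0}) \<union> R" S] cS q2 by auto
  then obtain x where x: "x \<in> S" "x \<notin> E" "x \<notin> R" by (auto simp: S_def)
  have ib: "inverse b \<notin> E" using b(2) E_inverse[of "inverse b"] by auto
  have B_eq: "B = span3 1 z b"
    using B b E_1 E_z by (intro span3_eq indep3_not_mem) (auto simp: S_def)
  have A_eq: "A = span3 1 z (inverse b)"
    using A b ib E_1 E_z by (intro span3_eq indep3_not_mem) (auto simp: S_def)
  have b0: "b \<noteq> 0" using b(2) E_0 by auto
  obtain e t where et: "e \<in> E" "x = e + emb t * b"
    using x(1) B_eq by (auto simp: S_def mem_span3_E)
  have "t \<noteq> 0" "e \<noteq> 0" using x(2,3) et by (auto simp: R_def)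
  define e1 where "e1 = emb (inverse t) * e"
  have e1: "e1 \<in> E" "e1 \<noteq> 0" using et(1) \<open>t \<noteq> 0\<close> \<open>e \<noteq> 0\<close> by (auto simp: e1_def E_scale)
  have "emb (inverse t) * x = e1 + b"
    using \<open>t \<noteq> 0\<close> by (simp add: e1_def et(2) emb_inverse distrib_left)
  then have "e1 + b \<in> S" using S_scale[OF x(1), of "inverse t"] \<open>t \<noteq> 0\<close> by simp
  then have nz: "e1 + b \<noteq> 0" and "inverse (e1 + b) \<in> span3 1 z (inverse b)"
    using A_eq by (simp_all add: S_def)
  then obtain f s where f: "f \<in> E" and inv: "inverse (e1 + b) = f + emb s * inverse b"
    by (auto simp: mem_span3_E)
  have "b = (e1 + b) * inverse (e1 + b) * b" using nz by simp
  also have "\<dots> = (e1 + b) * (f * b + emb s * (inverse b * b))" unfolding inv by (simp add: algebra_simps)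
  also have "\<dots> = f * (b * b) + (e1 * f + emb s) * b + e1 * emb s" using b0 by (simp add: algebra_simps)
  finally have rel: "f * (b * b) + (e1 * f + emb s - 1) * b + e1 * emb s = 0"
    by (simp add: algebra_simps)
  \<comment> \<open>In each degenerate case, \<open>f = 0\<close> or \<open>s = 0\<close>, the
    relation becomes linear over \<open>E\<close> and would put \<open>b\<close> into
    \<open>E\<close> or make \<open>e1\<close> zero.\<close>
  have "f \<noteq> 0"
  proof
    assume f0: "f = 0"
    have "emb s = 1"
    proof (rule ccontr)
      assume "emb s \<noteq> 1"
      then have "b = - (e1 * emb s) / (emb s - 1)" using rel f0
        by (subst eq_divide_eq) (simp add: add_eq_0_iff2 mult.commute)
      then show False using b(2) e1(1) by (metis E_intros)
    qed
    then show False using rel f0 e1(2) by simp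
  qed
  have "s \<noteq> 0"
  proof
    assume "s = 0"
    then have "(f * b + (e1 * f - 1)) * b = 0" using rel by (simp add: algebra_simps)
    then have "f * b + (e1 * f - 1) = 0" using b0 by (simp only: mult_eq_0_iff) simp
    then have "b * f = 1 - e1 * f" by (simp add: algebra_simps)
    then have "b = (1 - e1 * f) / f" using \<open>f \<noteq> 0\<close> by (subst eq_divide_eq) simp
    then show False using b(2) e1(1) f by (metis E_intros)
  qed
  show thesis
  proof (rule that[OF b(2) A_eq B_eq])
    show "- (e1 * f + emb s - 1) / f \<in> E" using e1(1) f by (intro E_intros)
    show "- (e1 * emb s) / f \<in> E" using e1(1) f by (intro E_intros)
    show "- (e1 * emb s) / f \<noteq> 0" using e1(2) \<open>s \<noteq> 0\<close> \<open>f \<noteq> 0\<close> by simp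
    have "f * (b * b) = - (e1 * f + emb s - 1) * b + - (e1 * emb s)"
      using rel by (simp add: algebra_simps)
    then have "f * (b * b) / f = (- (e1 * f + emb s - 1) * b + - (e1 * emb s)) / f" by simp
    then show "b * b = - (e1 * f + emb s - 1) / f * b + - (e1 * emb s) / f"
      using \<open>f \<noteq> 0\<close> by (simp only: add_divide_distrib) simp
  qed
qed

end

text \<open>\<open>\<phi>\<close> reads the coordinate at \<open>z\<close>, so its zeros on
  \<open>E\<close> are the scalars; \<open>\<tau>\<close> reads the coordinate at \<open>b\<close>,
  so its zeros on \<open>B\<close> are \<open>E\<close>. They turn membership conditions into
  equations over the ground field.\<close>

locale quadratic_section = quadratic_line emb q z E
  for emb :: "'k::{field,finite} \<Rightarrow> 'l::field" and q and z :: 'l and E :: "'l set" +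
  fixes b \<beta> \<gamma> :: 'l and A B S :: "'l set" and \<phi> \<tau> :: "'l \<Rightarrow> 'k"
  assumes b_notin: "b \<notin> E" and A_eq: "A = span3 1 z (inverse b)" and B_eq: "B = span3 1 z b"
    and \<beta>: "\<beta> \<in> E" and \<gamma>: "\<gamma> \<in> E" "\<gamma> \<noteq> 0" and bb: "b * b = \<beta> * b + \<gamma>"
    and S_def: "S = {x \<in> B. x \<noteq> 0 \<and> inverse x \<in> A}"
    and card_S: "card S = (q - 1) * (2 * q + 2)"
    and \<phi>_add: "\<phi> (x + y) = \<phi> x + \<phi> y" and \<phi>_scale: "\<phi> (emb k * x) = k * \<phi> x"
    and \<phi>_1: "\<phi> 1 = 0" and \<phi>_z: "\<phi> z = 1"
    and \<tau>_add: "\<tau> (x + y) = \<tau> x + \<tau> y" and \<tau>_scale: "\<tau> (emb k * x) = k * \<tau> x"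
    and \<tau>_1: "\<tau> 1 = 0" and \<tau>_z: "\<tau> z = 0" and \<tau>_b: "\<tau> b = 1"
begin

section \<open>The quadratic form and its zeros\<close>

definition pr :: "'l \<Rightarrow> 'l" where
  "pr x = x - emb (\<tau> x) * b"

text \<open>\<open>pr\<close> projects \<open>B\<close> onto \<open>E\<close> along
  \<open>b\<close>. The argument of \<open>\<phi>\<close> lies in \<open>E\<close>, so
  \<open>Q\<close> vanishes iff it is a scalar; \<open>mem_S_iff\<close> shows that off
  \<open>E\<close> this is the condition for membership in \<open>S\<close>.\<close>

definition Q :: "'l \<Rightarrow> 'k" where
  "Q x = \<phi> ((pr x * pr x + \<beta> * pr x * emb (\<tau> x)) / \<gamma>)"

lemma \<tau>_E: "e \<in> E \<Longrightarrow> \<tau> e = 0"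
  using \<tau>_scale[of _ 1] by (auto simp: E_def mem_span2_iff \<tau>_add \<tau>_scale \<tau>_1 \<tau>_z)

lemma \<phi>_0: "\<phi> 0 = 0" using \<phi>_scale[of 0 0] by simp

lemma \<phi>_minus: "\<phi> (- x) = - \<phi> x" using \<phi>_scale[of "-1" x] by (simp add: emb_minus)

lemma \<phi>_diff: "\<phi> (x - y) = \<phi> x - \<phi> y" using \<phi>_add[of x "- y"] by (simp add: \<phi>_minus)

lemma \<phi>_eq_0_iff:
  assumes "e \<in> E"
  shows "\<phi> e = 0 \<longleftrightarrow> e \<in> range emb"
proof -
  obtain r s where e: "e = emb r * 1 + emb s * z" using assms by (auto simp: E_def mem_span2_iff)
  have emb: "\<phi> (emb k) = 0" for k using \<phi>_scale[of k 1] by (simp add: \<phi>_1)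
  have "\<phi> e = s" unfolding e by (simp only: \<phi>_add \<phi>_scale \<phi>_1 \<phi>_z) simp
  then show ?thesis using e emb by auto
qed

lemma b_nonzero: "b \<noteq> 0"
  using b_notin E_0 by auto

lemma pr_coord: "e \<in> E \<Longrightarrow> pr (e + emb t * b) = e" and \<tau>_coord: "e \<in> E \<Longrightarrow> \<tau> (e + emb t * b) = t"
  by (simp_all add: pr_def \<tau>_add \<tau>_scale \<tau>_E \<tau>_b)

lemma Q_coord: "e \<in> E \<Longrightarrow> Q (e + emb t * b) = \<phi> ((e * e + \<beta> * e * emb t) / \<gamma>)"
  by (simp add: Q_def pr_coord \<tau>_coord)

lemma pr_add: "pr (x + y) = pr x + pr y"
  by (simp add: pr_def \<tau>_add emb_add algebra_simps)

lemma pr_scale: "pr (emb k * x) = emb k * pr x"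
  by (simp only: pr_def \<tau>_scale emb_mult) (simp add: algebra_simps)

lemma polar_Q: "polar_form Q x y =
  \<phi> ((2 * pr x * pr y + \<beta> * (pr x * emb (\<tau> y) + pr y * emb (\<tau> x))) / \<gamma>)"
  unfolding polar_form_def Q_def \<phi>_diff[symmetric]
  by (rule arg_cong[of _ _ \<phi>]) (simp add: pr_add \<tau>_add emb_add diff_divide_distrib[symmetric] algebra_simps)

lemma quadratic_form_Q: "quadratic_form_on (emb_scale emb) B Q"
  unfolding quadratic_form_on_def
proof (intro conjI allI ballI)
  fix c x show "Q (emb_scale emb c x) = c\<^sup>2 * Q x"
  proof -
    have "(pr (emb c * x) * pr (emb c * x) + \<beta> * pr (emb c * x) * emb (\<tau> (emb c * x))) / \<gamma> =
      emb (c\<^sup>2) * ((pr x * pr x + \<beta> * pr x * emb (\<tau> x)) / \<gamma>)"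
      by (simp only: pr_scale \<tau>_scale emb_mult power2_eq_square) (simp add: algebra_simps)
    then show ?thesis unfolding Q_def emb_scale_def by (simp only: \<phi>_scale)
  qed
next
  fix x y w
  show "polar_form Q (x + y) w = polar_form Q x w + polar_form Q y w"
    unfolding polar_Q \<phi>_add[symmetric]
    by (rule arg_cong[of _ _ \<phi>]) (simp add: pr_add \<tau>_add emb_add add_divide_distrib[symmetric] algebra_simps)
next
  fix c x y
  show "polar_form Q (emb_scale emb c x) y = c * polar_form Q x y"
    unfolding polar_Q \<phi>_scale[symmetric] emb_scale_def
    by (rule arg_cong[of _ _ \<phi>]) (simp only: pr_scale \<tau>_scale emb_mult, simp add: algebra_simps)
qed

text \<open>\<open>1\<close> and \<open>b\<close> are independent even over the field
  \<open>E\<close>, since a quotient of elements of \<open>E\<close> cannot be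
  \<open>b\<close>.\<close>

lemma E_b_unique:
  assumes "e \<in> E" "c \<in> E" "e = c * b"
  shows "c = 0"
proof (rule ccontr)
  assume "c \<noteq> 0"
  then have "b = e / c" using assms(3) by simp
  then show False using b_notin assms(1,2) by (metis E_divide)
qed

lemma diff_emb_mem_range_iff: "x - emb k \<in> range emb \<longleftrightarrow> x \<in> range emb"
proof
  assume "x - emb k \<in> range emb"
  then obtain l where "x - emb k = emb l" by blast
  then have "x = emb (l + k)" by (simp add: emb_add diff_eq_eq)
  then show "x \<in> range emb" by blast
next
  assume "x \<in> range emb"
  then obtain l where "x = emb l" by blast
  then have "x - emb k = emb (l - k)" by (simp add: emb_diff)
  then show "x - emb k \<in> range emb" by blast
qed

text \<open>The inverse is computed with the conjugate \<open>\<beta> - b\<close> of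
  \<open>b\<close>, which equals \<open>- \<gamma> * inverse b\<close>. It is
  \<open>e / M + c * inverse b\<close> with coefficients in \<open>E\<close>, so it lies in
  \<open>A\<close> iff \<open>c\<close> is a scalar, iff \<open>M / \<gamma>\<close> is one; there
  the summand \<open>- emb (t * t)\<close> is a scalar and drops out.\<close>

lemma mem_S_iff:
  assumes e: "e \<in> E" and t: "t \<noteq> 0"
  shows "e + emb t * b \<in> S \<longleftrightarrow> Q (e + emb t * b) = 0"
proof -
  \<comment> \<open>The norm of \<open>e + emb t * b\<close> over \<open>E\<close>.\<close>
  define M where "M = e * e + \<beta> * e * emb t - \<gamma> * (emb t * emb t)"
  have M_E: "M \<in> E" using e \<beta> \<gamma> unfolding M_def by (intro E_intros)
  have x0: "e + emb t * b \<noteq> 0"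
    using E_b_unique[OF E_minus[OF e] E_emb, of t] t by (auto simp: neg_eq_iff_add_eq_0)
  have y0: "(e + emb t * \<beta>) - emb t * b \<noteq> 0"
    using E_b_unique[OF E_add[OF e E_scale[OF \<beta>]] E_emb, of t t] t by auto
  have "(e + emb t * b) * ((e + emb t * \<beta>) - emb t * b) = e * e + e * (emb t * \<beta>) +
      emb t * emb t * (\<beta> * b - b * b)"
    by (simp add: algebra_simps)
  also have "\<dots> = M" unfolding bb by (simp add: M_def algebra_simps)
  finally have prod: "(e + emb t * b) * ((e + emb t * \<beta>) - emb t * b) = M" .
  then have M0: "M \<noteq> 0" using x0 y0 by auto
  have "(\<beta> - b) * b = - \<gamma>" using bb by (simp add: algebra_simps)
  then have bi: "\<beta> - b = - \<gamma> * inverse b" using b_nonzero by (simp add: field_simps)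
  define c where "c = - (emb t * \<gamma>) / M"
  have c_E: "c \<in> E" unfolding c_def using \<gamma> M_E by (intro E_intros)
  have "inverse (e + emb t * b) = ((e + emb t * \<beta>) - emb t * b) / M"
    using x0 M0 prod by (simp add: field_simps)
  also have "(e + emb t * \<beta>) - emb t * b = e + emb t * (\<beta> - b)" by (simp add: algebra_simps)
  also have "\<dots> / M = e / M + c * inverse b"
    unfolding bi c_def by (simp add: add_divide_distrib diff_divide_distrib)
  finally have inv: "inverse (e + emb t * b) = e / M + c * inverse b" .
  have "e / M + c * inverse b \<in> A \<longleftrightarrow> c \<in> range emb"
  proof
    assume "e / M + c * inverse b \<in> A"
    then obtain e' k where e': "e' \<in> E" "e / M + c * inverse b = e' + emb k * inverse b"
      by (auto simp: A_eq mem_span3_E)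
    then have "(e / M + c * inverse b) * b = (e' + emb k * inverse b) * b" by simp
    then have "e / M * b + c = e' * b + emb k" using b_nonzero by (simp add: distrib_right mult.assoc)
    then have "c - emb k = (e' - e / M) * b" by (simp add: algebra_simps)
    moreover from this have "e' - e / M = 0"
      by (rule E_b_unique[OF E_diff[OF c_E E_emb] E_diff[OF e'(1) E_divide[OF e M_E]]])
    ultimately show "c \<in> range emb" by simp
  next
    assume "c \<in> range emb"
    then show "e / M + c * inverse b \<in> A"
      using e M_E by (auto simp: A_eq mem_span3_E intro: E_divide)
  qed
  also have "\<dots> \<longleftrightarrow> M / \<gamma> \<in> range emb"
  proof
    assume "c \<in> range emb"
    then obtain k where k: "c = emb k" by auto
    then have "k \<noteq> 0" using M0 \<gamma>(2) t by (auto simp: c_def)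
    moreover have "M * emb k = - emb t * \<gamma>" using M0 unfolding k[symmetric] c_def by simp
    ultimately have "M / \<gamma> = - emb t / emb k"
      using \<gamma>(2) by (intro frac_eq_eq[THEN iffD2]) (simp only: emb_eq_0_iff not_False_eq_True)+
    then have "M / \<gamma> = emb (- t / k)" by (simp add: emb_divide emb_minus)
    then show "M / \<gamma> \<in> range emb" by simp
  next
    assume "M / \<gamma> \<in> range emb"
    then obtain k where k: "M / \<gamma> = emb k" by auto
    then have "k \<noteq> 0" using M0 \<gamma>(2) by auto
    moreover have "M = emb k * \<gamma>" using k \<gamma>(2) by (simp add: divide_eq_eq)
    ultimately have "c = emb (- t / k)"
      using M0 \<gamma>(2) by (simp add: c_def emb_divide emb_minus)
    then show "c \<in> range emb" by simp
  qed
  also have "M / \<gamma> = (e * e + \<beta> * e * emb t) / \<gamma> - emb (t * t)"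
    using \<gamma>(2) by (simp add: M_def emb_mult diff_divide_distrib)
  also have "\<dots> \<in> range emb \<longleftrightarrow> (e * e + \<beta> * e * emb t) / \<gamma> \<in> range emb"
    by (rule diff_emb_mem_range_iff)
  also have "\<dots> \<longleftrightarrow> Q (e + emb t * b) = 0"
    using e \<beta> \<gamma> by (subst \<phi>_eq_0_iff[symmetric]) (auto simp: Q_coord E_intros)
  finally have "inverse (e + emb t * b) \<in> A \<longleftrightarrow> Q (e + emb t * b) = 0" by (simp only: inv)
  then show ?thesis using x0 e by (auto simp: S_def B_eq mem_span3_E)
qed

lemma E_subset_S: "E - {0} \<subseteq> S"
proof -
  have "e \<in> span3 1 z c" if "e \<in> E" for e c
    using that unfolding mem_span3_E by (intro bexI[of _ e] exI[of _ 0]) auto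
  then show ?thesis by (auto simp: S_def A_eq B_eq E_inverse)
qed

lemma S_eq: "S = {x \<in> B. x \<noteq> 0 \<and> (x \<in> E \<or> Q x = 0)}"
proof (intro equalityI subsetI)
  fix x assume x: "x \<in> S"
  then obtain e t where et: "e \<in> E" "x = e + emb t * b" by (auto simp: S_def B_eq mem_span3_E)
  show "x \<in> {x \<in> B. x \<noteq> 0 \<and> (x \<in> E \<or> Q x = 0)}"
    using x et mem_S_iff[OF et(1), of t] by (cases "t = 0") (auto simp: S_def)
next
  fix x assume x: "x \<in> {x \<in> B. x \<noteq> 0 \<and> (x \<in> E \<or> Q x = 0)}"
  then obtain e t where et: "e \<in> E" "x = e + emb t * b" by (auto simp: B_eq mem_span3_E)
  show "x \<in> S"
  proof (cases "t = 0")
    case True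
    then show ?thesis using x et E_subset_S by auto
  next
    case False
    then have "x \<notin> E"
      using E_b_unique[OF E_diff[OF _ et(1)] E_emb, of x t] et(2) by auto
    then show ?thesis using x et mem_S_iff[OF et(1) False] by auto
  qed
qed

text \<open>The nonzero vectors of \<open>E\<close> give \<open>(q - 1) * (q + 1)\<close> elements
  of \<open>S\<close>, half of them. The other half consists of the nonzero multiples of the vectors
  \<open>e + b\<close> in \<open>S\<close>, which represent \<open>q + 1\<close> points.\<close>

lemma card_affine: "card {e \<in> E. Q (e + b) = 0} = q + 1"
proof -
  define X where "X = {e \<in> E. Q (e + b) = 0}"
  define U where "U = UNIV - {0::'k}"
  define S2 where "S2 = (\<lambda>(r, e). emb r * (e + b)) ` (U \<times> X)"
  have m: "emb r * (e + b) = emb r * e + emb r * b" for r e by (simp add: algebra_simps)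
  have XE: "X \<subseteq> E" and finX: "finite X" using finite_E by (auto simp: X_def)
  have inj: "inj_on (\<lambda>(r, e). emb r * (e + b)) (U \<times> X)"
  proof (rule inj_onI, clarify)
    fix r e r' e' assume I: "r \<in> U" "e \<in> X" "r' \<in> U" "e' \<in> X" and eq: "emb r * (e + b) = emb r' * (e' + b)"
    have "e \<in> E" "e' \<in> E" using I XE by auto
    then have "r = r'"
      using arg_cong[OF eq, of \<tau>] by (simp add: \<tau>_scale \<tau>_add \<tau>_b \<tau>_E)
    then show "r = r' \<and> e = e'" using eq I by (simp add: U_def)
  qed
  have c2: "card S2 = (q - 1) * card X"
    unfolding S2_def by (subst card_image[OF inj])
      (simp add: card_cartesian_product U_def card_Diff_singleton card_k)
  have Q1: "Q (e + b) = 0 \<longleftrightarrow> e + b \<in> S" if "e \<in> E" for e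
    using mem_S_iff[OF that, of 1] by simp
  have "S = (E - {0}) \<union> S2"
  proof (intro equalityI subsetI)
    fix x assume x: "x \<in> S"
    then obtain e t where et: "e \<in> E" "x = e + emb t * b" by (auto simp: S_def B_eq mem_span3_E)
    show "x \<in> (E - {0}) \<union> S2"
    proof (cases "t = 0")
      case True
      then show ?thesis using x et by (auto simp: S_def)
    next
      case False
      have eq: "emb t * (emb (inverse t) * e + b) = x"
        using False by (simp add: et(2) distrib_left flip: mult.assoc emb_mult)
      have "t\<^sup>2 * Q (emb (inverse t) * e + b) = Q x"
        using quadratic_form_Q unfolding quadratic_form_on_def emb_scale_def eq[symmetric]
        by (metis B_eq E_scale et(1) mem_span3_E emb_1 mult_1)
      moreover have "Q x = 0" using x mem_S_iff[OF et(1) False] et(2) by simp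
      ultimately have "emb (inverse t) * e \<in> X" using False et(1) by (simp add: X_def E_scale)
      then show ?thesis unfolding S2_def using eq False
        by (intro UnI2 image_eqI[of _ _ "(t, emb (inverse t) * e)"]) (auto simp: U_def)
    qed
  next
    fix x assume "x \<in> (E - {0}) \<union> S2"
    then show "x \<in> S"
    proof
      assume "x \<in> S2"
      then obtain r e where re: "r \<noteq> 0" "e \<in> E" "Q (e + b) = 0" "x = emb r * (e + b)"
        by (auto simp: S2_def U_def X_def)
      have eb: "e + b \<in> B" using re(2) unfolding B_eq mem_span3_E
        by (intro bexI[of _ e] exI[of _ 1]) auto
      have "Q x = 0"
        using quadratic_form_Q eb re(3,4) unfolding quadratic_form_on_def emb_scale_def by simp
      moreover have "x = emb r * e + emb r * b" using re by (simp add: algebra_simps)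
      ultimately show ?thesis using mem_S_iff[of "emb r * e" r] re(1,2) by (simp add: E_scale)
    qed (use E_subset_S in auto)
  qed
  moreover have "(E - {0}) \<inter> S2 = {}"
  proof -
    have "emb r * (e + b) \<notin> E" if "r \<noteq> 0" "e \<in> E" for r e
      using \<tau>_E[of "emb r * (e + b)"] that by (auto simp: \<tau>_scale \<tau>_add \<tau>_b \<tau>_E)
    then show ?thesis using XE by (auto simp: S2_def U_def)
  qed
  moreover have "finite S2" using finX by (simp add: S2_def U_def)
  ultimately have "card S = card (E - {0}) + card S2"
    using finite_E by (simp add: card_Un_disjoint)
  moreover have "card (E - {0}) = (q - 1) * (q + 1)"
    using E_0 q_gt_3
    by (simp add: card_Diff_singleton E_def card_span2 ind_E power2_eq_square algebra_simps)
  ultimately have "(q - 1) * (2 * q + 2) = (q - 1) * (q + 1 + card X)"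
    using card_S c2 by (simp only: distrib_left)
  then have "2 * q + 2 = q + 1 + card X"
    using q_gt_3 by (subst (asm) mult_cancel1) simp
  then show ?thesis by (simp add: X_def)
qed

text \<open>
  Otherwise the zeros of \<open>Q\<close> form a cone over the points of \<open>E\<close> at which \<open>e\<^sup>2 / \<gamma>\<close> lies in \<open>K\<close>,
  and the scalars act freely on the \<open>q\<close> affine zeros other than its vertex.
\<close>

lemma discriminant: "\<phi> (\<beta> * \<beta> / \<gamma>) \<noteq> 0"
proof
  assume d0: "\<phi> (\<beta> * \<beta> / \<gamma>) = 0"
  define X where "X = {e \<in> E. Q (e + b) = 0}"
  define Y where "Y = {e \<in> E. \<phi> (e * e / \<gamma>) = 0}"
  have h: "emb (inverse 2) * \<beta> \<in> E" using \<beta> by (rule E_scale)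
  \<comment> \<open>Completing the square; the constant left over, a quarter of
    \<open>\<phi> (\<beta> * \<beta> / \<gamma>)\<close>, is zero by \<open>d0\<close>.\<close>
  have "Q (e + b) = \<phi> ((e + emb (inverse 2) * \<beta>) * (e + emb (inverse 2) * \<beta>) / \<gamma>)" if e: "e \<in> E" for e
  proof -
    have "(e + emb (inverse 2) * \<beta>) * (e + emb (inverse 2) * \<beta>) / \<gamma> =
      (e * e + \<beta> * e) / \<gamma> + emb (inverse 4) * (\<beta> * \<beta> / \<gamma>)"
    proof -
      have "emb (inverse 2) + emb (inverse 2) = 1"
        using two_ne_0_k by (simp add: field_simps flip: emb_add)
      moreover have "emb (inverse 2) * emb (inverse 2) = emb (inverse 4)"
        by (simp flip: emb_mult)
      moreover have "(e + k * \<beta>) * (e + k * \<beta>) = e * e + (k + k) * (\<beta> * e) + (k * k) * (\<beta> * \<beta>)" for k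
        by (simp add: algebra_simps)
      ultimately show ?thesis by (simp add: add_divide_distrib)
    qed
    then show ?thesis using d0 Q_coord[OF e, of 1] by (simp only: \<phi>_add \<phi>_scale) simp
  qed
  then have "bij_betw (\<lambda>e. e + emb (inverse 2) * \<beta>) X Y"
    using h by (intro bij_betw_byWitness[of _ "\<lambda>e. e - emb (inverse 2) * \<beta>"])
      (auto simp: X_def Y_def E_intros)
  then have cY: "card Y = q + 1" using card_affine bij_betw_same_card[of _ X Y] by (simp add: X_def)
  have Y0: "0 \<in> Y" by (simp add: Y_def E_0 \<phi>_0)
  have Y_scale: "emb k * e \<in> Y" if "e \<in> Y" for k e
  proof -
    have "emb k * e * (emb k * e) / \<gamma> = emb (k * k) * (e * e / \<gamma>)" by (simp add: emb_mult)
    then have "\<phi> (emb k * e * (emb k * e) / \<gamma>) = k * k * \<phi> (e * e / \<gamma>)" by (simp only: \<phi>_scale)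
    then show ?thesis using that by (simp add: Y_def E_scale)
  qed
  \<comment> \<open>The orbits of the nonzero scalars on \<open>Y - {0}\<close>. Each has
    \<open>q - 1\<close> elements, so \<open>q - 1\<close> would divide \<open>q\<close>.\<close>
  define C where "C = (\<lambda>e. (\<lambda>k. emb k * e) ` (UNIV - {0})) ` (Y - {0})"
  have "\<Union> C = Y - {0}"
  proof (intro equalityI subsetI)
    fix e assume e: "e \<in> Y - {0}"
    then show "e \<in> \<Union> C"
      unfolding C_def by (intro UnionI[OF imageI[OF e]] image_eqI[of _ _ 1]) auto
  qed (auto simp: C_def Y_scale)
  moreover have "(q - 1) dvd card (\<Union> C)"
  proof (rule dvd_partition)
    show "finite (\<Union> C)" using \<open>\<Union> C = Y - {0}\<close> finite_E by (simp add: Y_def)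
    show "\<forall>c\<in>C. (q - 1) dvd card c"
      by (auto simp: C_def card_image inj_on_def card_Diff_singleton card_k)
    show "\<forall>c1\<in>C. \<forall>c2\<in>C. c1 \<noteq> c2 \<longrightarrow> c1 \<inter> c2 = {}"
    proof (intro ballI impI)
      fix c1 c2 assume c: "c1 \<in> C" "c2 \<in> C" "c1 \<noteq> c2"
      obtain e1 e2 where e: "c1 = (\<lambda>k. emb k * e1) ` (UNIV - {0})" "c2 = (\<lambda>k. emb k * e2) ` (UNIV - {0})"
        using c by (auto simp: C_def)
      have sub: "(\<lambda>k. emb k * e1) ` (UNIV - {0}) \<subseteq> (\<lambda>k. emb k * e2) ` (UNIV - {0})"
        if "emb k1 * e1 = emb k2 * e2" "k1 \<noteq> 0" "k2 \<noteq> 0" for k1 k2 e1 e2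
      proof (rule image_subsetI)
        fix k :: 'k assume k: "k \<in> UNIV - {0}"
        have "emb k * e1 = emb (k * k2 / k1) * e2"
          using that by (simp add: emb_mult emb_divide field_simps)
        then show "emb k * e1 \<in> (\<lambda>k. emb k * e2) ` (UNIV - {0})"
          using k that by (intro image_eqI[of _ _ "k * k2 / k1"]) auto
      qed
      show "c1 \<inter> c2 = {}"
      proof (rule ccontr)
        assume "c1 \<inter> c2 \<noteq> {}"
        then obtain k1 k2 where "emb k1 * e1 = emb k2 * e2" "k1 \<noteq> 0" "k2 \<noteq> 0" using e by auto
        then show False using sub[of k1 e1 k2 e2] sub[of k2 e2 k1 e1] c(3) e by auto
      qed
    qed
  qed
  moreover have "card (Y - {0}) = q" using cY Y0 by (simp add: card_Diff_singleton)
  ultimately have "(q - 1) dvd q - (q - 1)" by (simp only: dvd_diff_nat dvd_refl)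
  then show False using q_gt_3 by simp
qed

text \<open>For \<open>e + emb t * b\<close> in the radical, pairing with \<open>E\<close> forces
  \<open>w = 2 * e + emb t * \<beta>\<close> to be zero, as otherwise
  \<open>\<gamma> * z / w\<close> pairs to \<open>\<phi> z = 1\<close>. Pairing with
  \<open>b\<close> then gives \<open>t * \<phi> (\<beta> * \<beta> / \<gamma>) = 0\<close>, so
  \<open>t = 0\<close> by \<open>discriminant\<close>, and finally \<open>e = 0\<close>.\<close>

lemma nondegenerate_Q: "nondegenerate_on B Q"
  unfolding nondegenerate_on_def
proof (intro ballI impI)
  fix x assume x: "x \<in> B" and rad: "\<forall>y\<in>B. polar_form Q x y = 0"
  obtain e t where et: "e \<in> E" "x = e + emb t * b" using x by (auto simp: B_eq mem_span3_E)
  have E_B: "y \<in> B" if "y \<in> E" for y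
    using that unfolding B_eq mem_span3_E by (intro bexI[of _ y] exI[of _ 0]) auto
  have b_B: "b \<in> B" by (simp add: B_eq mem_span3)
  define w where "w = 2 * e + emb t * \<beta>"
  have "2 * e = emb 2 * e" by simp
  then have wE: "w \<in> E" unfolding w_def using et(1) \<beta> by (simp only: E_intros)
  have w0: "w = 0"
  proof (rule ccontr)
    assume w: "w \<noteq> 0"
    have y: "\<gamma> * z / w \<in> E" using wE \<gamma> by (intro E_intros)
    have py: "pr (\<gamma> * z / w) = \<gamma> * z / w" using pr_coord[OF y, of 0] by simp
    have "polar_form Q x (\<gamma> * z / w) = \<phi> ((w * (\<gamma> * z / w)) / \<gamma>)"
      unfolding polar_Q et(2) pr_coord[OF et(1)] \<tau>_coord[OF et(1)] py \<tau>_E[OF y]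
      by (rule arg_cong[of _ _ "\<lambda>x. \<phi> (x / \<gamma>)"]) (simp add: w_def add_divide_distrib[symmetric] algebra_simps)
    also have "(w * (\<gamma> * z / w)) / \<gamma> = z" using w \<gamma>(2) by simp
    finally show False using rad E_B[OF y] \<phi>_z by simp
  qed
  have pb: "pr b = 0" "\<tau> b = 1" by (simp_all add: pr_def \<tau>_b)
  have "0 = polar_form Q x b" using rad b_B by simp
  also have "\<dots> = \<phi> (\<beta> * e / \<gamma>)"
    unfolding polar_Q et(2) pr_coord[OF et(1)] \<tau>_coord[OF et(1)] pb by simp
  finally have "\<phi> (emb 2 * (\<beta> * e / \<gamma>)) = 0" by (simp only: \<phi>_scale mult_zero_right)
  also have "emb 2 * (\<beta> * e / \<gamma>) = emb (- t) * (\<beta> * \<beta> / \<gamma>)"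
  proof -
    have "2 * e = - (emb t * \<beta>)" using w0 by (simp add: w_def add_eq_0_iff2)
    then have "\<beta> * (2 * e) / \<gamma> = \<beta> * (- (emb t * \<beta>)) / \<gamma>" by simp
    then show ?thesis by (simp add: emb_minus algebra_simps)
  qed
  finally have "- t * \<phi> (\<beta> * \<beta> / \<gamma>) = 0" by (simp only: \<phi>_scale)
  then have "t = 0" using discriminant by simp
  then show "x = 0" using w0 et(2) by (simp add: w_def)
qed

end

section \<open>The case of a line through \<open>1\<close>\<close>

context finite_field_extension
begin

lemma section_normalized:
  assumes A: "subspace A" "card A = q ^ 3" and B: "subspace B" "card B = q ^ 3"
    and ind: "indep2 1 z" and zB: "1 \<in> B" "z \<in> B"
    and line: "\<And>r s. (r, s) \<noteq> (0, 0) \<Longrightarrow> inverse (emb r + emb s * z) \<in> A"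
    and card: "card (inverse_set A \<inter> B) = (q - 1) * (2 * q + 2)"
  obtains Q where "quadratic_form_on (emb_scale emb) B Q" "nondegenerate_on B Q"
    "inverse_set A \<inter> B = {x \<in> B. x \<noteq> 0 \<and> (x \<in> span2 1 z \<or> Q x = 0)}"
proof -
  interpret quadratic_line emb q z "span2 1 z"
    by unfold_locales (use ind inverse_line_quadratic[OF A B ind zB line card] in auto)
  have set: "inverse_set A \<inter> B = {x \<in> B. x \<noteq> 0 \<and> inverse x \<in> A}"
    by (force simp: inverse_set_def)
  have inv: "inverse x \<in> A" if "x \<in> span2 1 z" for x
  proof -
    obtain r s where "x = emb r * 1 + emb s * z" using \<open>x \<in> span2 1 z\<close> unfolding mem_span2_iff by blast
    then show ?thesis using line[of r s] A(1) by (cases "r = 0 \<and> s = 0") (auto simp: subspace_0)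
  qed
  have EA: "span2 1 z \<subseteq> A"
    using inv[OF E_inverse] by force
  have EB: "span2 1 z \<subseteq> B" using B(1) zB by (intro span2_subset)
  obtain b \<beta> \<gamma> where b: "b \<notin> span2 1 z" "A = span3 1 z (inverse b)" "B = span3 1 z b"
    "\<beta> \<in> span2 1 z" "\<gamma> \<in> span2 1 z" "\<gamma> \<noteq> 0" "b * b = \<beta> * b + \<gamma>"
    by (rule quadratic_relation[OF A EA B EB card[unfolded set]])
  obtain \<phi> where \<phi>: "\<And>x y. \<phi> (x + y) = \<phi> x + \<phi> y" "\<And>k x. \<phi> (emb k * x) = k * \<phi> x"
    "\<phi> 1 = 0" "\<phi> z = 1" by (rule functional_extends[OF indep3_not_mem[OF b(1)], of 0 1 0]) (rule that)
  obtain \<tau> where \<tau>: "\<And>x y. \<tau> (x + y) = \<tau> x + \<tau> y" "\<And>k x. \<tau> (emb k * x) = k * \<tau> x"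
    "\<tau> 1 = 0" "\<tau> z = 0" "\<tau> b = 1" by (rule functional_extends[OF indep3_not_mem[OF b(1)], of 0 0 1]) (rule that)
  interpret quadratic_section emb q z "span2 1 z" b \<beta> \<gamma> A B "inverse_set A \<inter> B" \<phi> \<tau>
    by (unfold_locales; (fact b \<phi> \<tau> set card)?)
  show thesis using that[OF quadratic_form_Q nondegenerate_Q S_eq] .
qed

section \<open>Removing the normalization by a dilation\<close>

lemma polar_form_dilation: "polar_form (\<lambda>x. Q (c * x)) x y = polar_form Q (c * x) (c * y)"
  for c :: 'l and Q :: "'l \<Rightarrow> 'k"
  unfolding polar_form_def by (simp only: distrib_left)

lemma quadratic_form_on_dilation:
  fixes Q :: "'l \<Rightarrow> 'k"
  assumes "quadratic_form_on (emb_scale emb) ((\<lambda>x. c * x) ` V) Q"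
  shows "quadratic_form_on (emb_scale emb) V (\<lambda>x. Q (c * x))"
  unfolding quadratic_form_on_def polar_form_dilation emb_scale_def
proof (intro conjI allI ballI)
  note Q = assms[unfolded quadratic_form_on_def emb_scale_def]
  have com: "c * (emb k * x) = emb k * (c * x)" for k x by (rule mult.left_commute)
  show "Q (c * (emb k * x)) = k\<^sup>2 * Q (c * x)" if "x \<in> V" for k x
    unfolding com using Q that by blast
  show "polar_form Q (c * (x + y)) (c * w) = polar_form Q (c * x) (c * w) + polar_form Q (c * y) (c * w)"
    if "x \<in> V" "y \<in> V" "w \<in> V" for x y w
    unfolding distrib_left using Q that by blast
  show "polar_form Q (c * (emb k * x)) (c * y) = k * polar_form Q (c * x) (c * y)"
    if "x \<in> V" "y \<in> V" for k x y
    unfolding com using Q that by blast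
qed

lemma nondegenerate_on_dilation:
  fixes Q :: "'l \<Rightarrow> 'k"
  assumes "nondegenerate_on ((\<lambda>x. c * x) ` V) Q" "c \<noteq> 0"
  shows "nondegenerate_on V (\<lambda>x. Q (c * x))"
  unfolding nondegenerate_on_def polar_form_dilation
proof (intro ballI impI)
  fix x assume "x \<in> V" "\<forall>y\<in>V. polar_form Q (c * x) (c * y) = 0"
  then have "c * x = 0" using assms(1) unfolding nondegenerate_on_def by blast
  then show "x = 0" using assms(2) by simp
qed

lemma subspace_dilation: "subspace V \<Longrightarrow> subspace ((\<lambda>x. c * x) ` V)"
  unfolding subspace_iff
proof (intro conjI ballI allI)
  assume V: "0 \<in> V \<and> (\<forall>x\<in>V. \<forall>y\<in>V. x + y \<in> V) \<and> (\<forall>k. \<forall>x\<in>V. emb k * x \<in> V)"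
  then show "0 \<in> (\<lambda>x. c * x) ` V" by (intro image_eqI[of _ _ 0]) auto
  fix x assume "x \<in> (\<lambda>x. c * x) ` V"
  then obtain x' where x: "x' \<in> V" "x = c * x'" by blast
  show "emb k * x \<in> (\<lambda>x. c * x) ` V" for k
    using V x by (intro image_eqI[of _ _ "emb k * x'"]) auto
  fix y assume "y \<in> (\<lambda>x. c * x) ` V"
  then obtain y' where y: "y' \<in> V" "y = c * y'" by blast
  show "x + y \<in> (\<lambda>x. c * x) ` V"
    using V x y by (intro image_eqI[of _ _ "x' + y'"]) (auto simp: distrib_left)
qed

text \<open>Multiplying \<open>A\<close> by \<open>x\<close> divides the set of inverses by
  \<open>x\<close>, as is done to \<open>B\<close>, so the whole section is dilated and the line of
  \<open>x\<close> and \<open>y\<close> moves to that of \<open>1\<close> and \<open>z\<close>. The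
  form found there is pulled back along the dilation.\<close>

lemma section_line_conic:
  assumes A: "subspace A" "card A = q ^ 3" and B: "subspace B" "card B = q ^ 3"
    and card: "card (inverse_set A \<inter> B) = (q - 1) * (2 * q + 2)"
  obtains x y Q where "indep2 x y" "x \<in> B" "y \<in> B"
    "quadratic_form_on (emb_scale emb) B Q" "nondegenerate_on B Q"
    "inverse_set A \<inter> B = {w \<in> B. w \<noteq> 0 \<and> (w \<in> span2 x y \<or> Q w = 0)}"
proof -
  obtain x y where xy: "indep2 x y" "x \<in> B" "y \<in> B"
    and line: "\<And>r s. (r, s) \<noteq> (0, 0) \<Longrightarrow> inverse (emb r * x + emb s * y) \<in> A"
    by (rule contains_line[OF A B card]) (rule that)
  have x0: "x \<noteq> 0" using xy(1)[unfolded indep2_def, rule_format, of 1 0] by auto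
  define z where "z = inverse x * y"
  have y: "y = x * z" using x0 by (simp add: z_def)
  define A' B' where "A' = (\<lambda>a. x * a) ` A" and "B' = (\<lambda>b. inverse x * b) ` B"
  have A': "subspace A'" "card A' = q ^ 3" and B': "subspace B'" "card B' = q ^ 3"
    using A B x0 by (simp_all add: A'_def B'_def subspace_dilation card_image inj_on_def)
  have mem: "inverse x * w \<in> inverse_set A' \<inter> B' \<longleftrightarrow> w \<in> inverse_set A \<inter> B" for w
    using x0 by (force simp: A'_def B'_def inverse_set_def image_iff)
  have "inverse_set A' \<inter> B' = (\<lambda>w. inverse x * w) ` (inverse_set A \<inter> B)"
  proof (intro equalityI subsetI)
    fix w assume w: "w \<in> inverse_set A' \<inter> B'"
    have eq: "w = inverse x * (x * w)" using x0 by (simp flip: mult.assoc)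
    with w mem[of "x * w"] have "x * w \<in> inverse_set A \<inter> B" by argo
    with eq show "w \<in> (\<lambda>w. inverse x * w) ` (inverse_set A \<inter> B)" by (rule image_eqI)
  qed (use mem in auto)
  then have card': "card (inverse_set A' \<inter> B') = (q - 1) * (2 * q + 2)"
    using card x0 by (simp add: card_image inj_on_def)
  have lin: "emb r * x + emb s * y = x * (emb r * 1 + emb s * z)" for r s
    by (simp add: y algebra_simps)
  have ind: "indep2 1 z"
    using xy(1) x0 unfolding indep2_def lin by simp
  have zB: "1 \<in> B'" "z \<in> B'" using imageI[OF xy(2), of "\<lambda>b. inverse x * b"] xy(3) x0 by (auto simp: B'_def z_def)
  have line': "inverse (emb r + emb s * z) \<in> A'" if "(r, s) \<noteq> (0, 0)" for r s
    using line[OF that] x0 unfolding lin A'_def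
    by (intro image_eqI[of _ _ "inverse (x * (emb r * 1 + emb s * z))"]) auto
  obtain Q where Q: "quadratic_form_on (emb_scale emb) B' Q" "nondegenerate_on B' Q"
    "inverse_set A' \<inter> B' = {w \<in> B'. w \<noteq> 0 \<and> (w \<in> span2 1 z \<or> Q w = 0)}"
    by (rule section_normalized[OF A' B' ind zB _ card']) (rule line', assumption, rule that)
  have span: "inverse x * w \<in> span2 1 z \<longleftrightarrow> w \<in> span2 x y" for w
    unfolding mem_span2_iff lin using x0 by (auto simp: field_simps)
  show thesis
  proof (rule that[OF xy])
    show "quadratic_form_on (emb_scale emb) B (\<lambda>w. Q (inverse x * w))"
      using Q(1) unfolding B'_def by (rule quadratic_form_on_dilation)
    show "nondegenerate_on B (\<lambda>w. Q (inverse x * w))"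
      using Q(2) x0 unfolding B'_def by (intro nondegenerate_on_dilation) auto
    have "inverse x * w \<in> B' \<longleftrightarrow> w \<in> B" for w using x0 by (auto simp: B'_def)
    then show "inverse_set A \<inter> B = {w \<in> B. w \<noteq> 0 \<and> (w \<in> span2 x y \<or> Q (inverse x * w) = 0)}"
      using mem x0 unfolding Q(3) by (auto simp: span set_eq_iff)
  qed
qed

section \<open>Projective points and lines\<close>

lemma dim_1_iff:
  assumes "subspace P"
  shows "dim P = 1 \<longleftrightarrow> (\<exists>x. x \<noteq> 0 \<and> P = span {x})"
proof
  assume "dim P = 1"
  obtain X where X: "X \<subseteq> P" "independent X" "P \<subseteq> span X" "card X = dim P"
    using basis_exists by metis
  then obtain x where x: "X = {x}" using \<open>dim P = 1\<close> by (auto simp: card_1_singleton_iff)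
  then have "x \<noteq> 0" using X(2) dependent_zero by auto
  moreover have "P = span {x}" using X x assms by (metis span_minimal subset_antisym)
  ultimately show "\<exists>x. x \<noteq> 0 \<and> P = span {x}" by blast
next
  assume "\<exists>x. x \<noteq> 0 \<and> P = span {x}"
  then obtain x where "x \<noteq> 0" "P = span {x}" by blast
  moreover from this have "independent {x}"
    by (metis independent_empty independent_insertI span_empty singletonD)
  ultimately show "dim P = 1" using dim_span_eq_card_independent[of "{x}"] by simp
qed

lemma proj_points_eq:
  assumes "subspace V"
  shows "proj_points (emb_scale emb) V = {span {x} | x. x \<in> V \<and> x \<noteq> 0}"
proof -
  have "span {x} \<subseteq> V \<longleftrightarrow> x \<in> V" for x
    using assms by (meson span_base span_minimal singletonI empty_subsetI insert_subset subsetD)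
  then show ?thesis
    unfolding proj_points_def using dim_1_iff subspace_span by (intro equalityI subsetI) force+
qed

lemma span2_eq_span: "span2 x y = span {x, y}"
proof -
  have "w \<in> span2 x y \<longleftrightarrow> w \<in> span {x, y}" for w
    unfolding mem_span2_iff span_insert[of x "{y}"] span_singleton emb_scale_def
    by (simp add: image_iff diff_eq_eq add.commute)
  then show ?thesis by blast
qed

lemma dim_span2:
  assumes "indep2 x y"
  shows "dim (span2 x y) = 2"
proof -
  have ne: "x \<noteq> y" using assms[unfolded indep2_def, rule_format, of 1 "-1"] by (auto simp: emb_minus)
  have "y \<noteq> 0" using assms[unfolded indep2_def, rule_format, of 0 1] by auto
  then have "independent {y}" by (metis independent_empty independent_insertI span_empty singletonD)
  moreover have "x \<notin> span {y}"
  proof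
    assume "x \<in> span {y}"
    then obtain k where "x = emb k * y" by (auto simp: span_singleton emb_scale_def)
    then show False using assms[unfolded indep2_def, rule_format, of 1 "-k"] by (auto simp: emb_minus)
  qed
  ultimately have "independent {x, y}" by (simp add: independent_insertI)
  then show ?thesis using dim_span_eq_card_independent[of "{x, y}"] ne by (simp add: span2_eq_span)
qed

end

theorem theorem5:
  fixes emb :: "'k::{field,finite} \<Rightarrow> 'l::alg_closed_field"
    and q :: nat
    and A B :: "'l set"
  assumes "card (UNIV :: 'k set) = q"
    and "primepow q" and "odd q" and "q > 3"
    and "is_algebraic_closure emb"
    and "module.subspace (emb_scale emb) A" and "card A = q ^ 3"
    and "module.subspace (emb_scale emb) B" and "card B = q ^ 3"
    and "\<not> inverse_set A \<subseteq> B"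
    and "real (card (inverse_set A \<inter> B)) / (real q - 1) = 2 * real q + 2"
  shows "\<exists>L C. is_proj_line (emb_scale emb) B L \<and>
               is_conic (emb_scale emb) B C \<and>
               proj_image (emb_scale emb) (inverse_set A \<inter> B) = L \<union> C"
proof -
  interpret finite_field_extension emb q
    using assms(1-5) by unfold_locales (auto simp: is_algebraic_closure_def)
  note B = assms(8,9)
  have "real (card (inverse_set A \<inter> B)) = real ((q - 1) * (2 * q + 2))"
    using assms(11) q_gt_3 by (simp add: field_simps of_nat_diff)
  then have card: "card (inverse_set A \<inter> B) = (q - 1) * (2 * q + 2)" by (simp only: of_nat_eq_iff)
  obtain x y Q where xy: "indep2 x y" "x \<in> B" "y \<in> B"
    and Q: "quadratic_form_on (emb_scale emb) B Q" "nondegenerate_on B Q"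
    and S: "inverse_set A \<inter> B = {w \<in> B. w \<noteq> 0 \<and> (w \<in> span2 x y \<or> Q w = 0)}"
    using section_line_conic[OF assms(6,7) B card] .
  define L where "L = {P \<in> proj_points (emb_scale emb) B. P \<subseteq> span2 x y}"
  define C where "C = {P \<in> proj_points (emb_scale emb) B. \<forall>w\<in>P. Q w = 0}"
  have "is_proj_line (emb_scale emb) B L"
    unfolding is_proj_line_def L_def
    using subspace_span2 span2_subset[OF B(1) xy(2,3)] dim_span2[OF xy(1)] by blast
  moreover have "is_conic (emb_scale emb) B C"
    unfolding is_conic_def C_def using Q by blast
  moreover have "proj_image (emb_scale emb) (inverse_set A \<inter> B) = L \<union> C"
  proof -
    have "span {w} \<subseteq> span2 x y \<longleftrightarrow> w \<in> span2 x y" for w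
      using subspace_span2
      by (meson span_base span_minimal singletonI empty_subsetI insert_subset subsetD)
    \<comment> \<open>By homogeneity, vanishing at a generator is the same as vanishing on the whole
      point, which is what \<open>is_conic\<close> asks for.\<close>
    moreover have "(\<forall>v\<in>span {w}. Q v = 0) \<longleftrightarrow> Q w = 0" if "w \<in> B" for w
      using Q(1) that by (auto simp: span_singleton quadratic_form_on_def intro: span_base)
    ultimately show ?thesis
      unfolding proj_image_def S L_def C_def proj_points_eq[OF B(1)] by blast
  qed
  ultimately show ?thesis by blast
qed

end
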